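(* Let $b \ge a \ge 2$ be integers, and let $G$ be a graph of order $n \ge 6a+5$. If $q(G) \ge q(H_{n,a})$, then $G$ is a fractional $[a,b]$-covered graph unless $G \cong H_{n,a}$.
   Context: All graphs are finite, simple and undirected. $q(G)$ denotes the signless Laplacian spectral radius of $G$, i.e. the largest eigenvalue of $D(G)+A(G)$, where $D(G)$ is the diagonal degree matrix and $A(G)$ the adjacency matrix. For graphs $G_1,G_2$, the join $G_1\nabla G_2$ is obtained from the disjoint union $G_1\cup G_2$ by adding all edges between $G_1$ and $G_2$. For integers $2\le a\le n$, $H_{n,a}:=K_{a-1}\nabla (K_1\cup K_{n-a})$. For positive integers $a\le b$, a fractional $[a,b]$-factor of $G$ with indicator function $h$ is given by a function $h:E(G)\to[0,1]$ with $a\le \sum_{e\in E_G(x)} h(e)\le b$ for every vertex $x$, where $E_G(x)$ is the set of edges incident with $x$. $G$ is fractional $[a,b]$-covered if for every edge $e$ of $G$ there is a fractional $[a,b]$-factor with indicator function $h$ such that $h(e)=1$. *)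

theory Defs
  imports "Jordan_Normal_Form.Spectral_Radius"
begin

text \<open>An undirected graph is a vertex set together with a set of edges, each edge being the
  two-element set of its end vertices.\<close>

record 'v graph =
  verts :: "'v set"
  edges :: "'v set set"

definition simple_graph :: "'v graph \<Rightarrow> bool" where
  "simple_graph G \<longleftrightarrow>
     finite (verts G) \<and> (\<forall>e \<in> edges G. e \<subseteq> verts G \<and> card e = 2)"

definition incident_edges :: "'v graph \<Rightarrow> 'v \<Rightarrow> 'v set set" where
  "incident_edges G x = {e \<in> edges G. x \<in> e}"

definition vdegree :: "'v graph \<Rightarrow> 'v \<Rightarrow> nat" where
  "vdegree G x = card (incident_edges G x)"

definition graph_iso :: "'v graph \<Rightarrow> 'w graph \<Rightarrow> bool" where
  "graph_iso G H \<longleftrightarrow>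
     (\<exists>f. bij_betw f (verts G) (verts H) \<and>
          (\<forall>u \<in> verts G. \<forall>v \<in> verts G. {u, v} \<in> edges G \<longleftrightarrow> {f u, f v} \<in> edges H))"

definition complete_graph :: "nat \<Rightarrow> nat graph" where
  "complete_graph n =
     \<lparr>verts = {..<n}, edges = {{u, v} | u v. u < n \<and> v < n \<and> u \<noteq> v}\<rparr>"

definition disjoint_union :: "'v graph \<Rightarrow> 'w graph \<Rightarrow> ('v + 'w) graph" where
  "disjoint_union G H =
     \<lparr>verts = verts G <+> verts H,
      edges = (\<lambda>e. Inl ` e) ` edges G \<union> (\<lambda>e. Inr ` e) ` edges H\<rparr>"

definition graph_join :: "'v graph \<Rightarrow> 'w graph \<Rightarrow> ('v + 'w) graph" where
  "graph_join G H =
     \<lparr>verts = verts (disjoint_union G H),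
      edges = edges (disjoint_union G H) \<union>
              {{Inl u, Inr v} | u v. u \<in> verts G \<and> v \<in> verts H}\<rparr>"

text \<open>Intended for \<open>2 \<le> a \<le> n\<close>, so that the subtractions are not truncated.\<close>

definition H_graph :: "nat \<Rightarrow> nat \<Rightarrow> (nat + (nat + nat)) graph" where
  "H_graph n a =
     graph_join (complete_graph (a - 1))
       (disjoint_union (complete_graph 1) (complete_graph (n - a)))"

text \<open>Matrices are indexed by \<open>0, \<dots>, n - 1\<close>, so the vertices have to be numbered. The numbering is
  an arbitrary one; another choice conjugates all matrices below by the same permutation
  matrix and leaves their spectra unchanged.\<close>

definition vertex_enum :: "'v graph \<Rightarrow> nat \<Rightarrow> 'v" where
  "vertex_enum G = (SOME f. bij_betw f {..<card (verts G)} (verts G))"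

definition adjacency_matrix :: "'v graph \<Rightarrow> real mat" where
  "adjacency_matrix G =
     mat (card (verts G)) (card (verts G))
       (\<lambda>(i, j). if {vertex_enum G i, vertex_enum G j} \<in> edges G then 1 else 0)"

definition degree_matrix :: "'v graph \<Rightarrow> real mat" where
  "degree_matrix G =
     mat (card (verts G)) (card (verts G))
       (\<lambda>(i, j). if i = j then real (vdegree G (vertex_enum G i)) else 0)"

definition signless_laplacian :: "'v graph \<Rightarrow> real mat" where
  "signless_laplacian G = degree_matrix G + adjacency_matrix G"

text \<open>The matrix is real symmetric, so its real spectrum is its whole spectrum; the maximum is
  meaningful for every simple graph with at least one vertex.\<close>

definition signless_laplacian_radius :: "'v graph \<Rightarrow> real" where
  "signless_laplacian_radius G = Max (spectrum (signless_laplacian G))"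

text \<open>Only the values of the indicator function on the edges of the graph matter.\<close>

definition fractional_factor :: "nat \<Rightarrow> nat \<Rightarrow> 'v graph \<Rightarrow> ('v set \<Rightarrow> real) \<Rightarrow> bool" where
  "fractional_factor a b G h \<longleftrightarrow>
     (\<forall>e \<in> edges G. 0 \<le> h e \<and> h e \<le> 1) \<and>
     (\<forall>x \<in> verts G. real a \<le> (\<Sum>e \<in> incident_edges G x. h e) \<and>
                   (\<Sum>e \<in> incident_edges G x. h e) \<le> real b)"

definition fractional_covered :: "nat \<Rightarrow> nat \<Rightarrow> 'v graph \<Rightarrow> bool" where
  "fractional_covered a b G \<longleftrightarrow>
     (\<forall>e \<in> edges G. \<exists>h. fractional_factor a b G h \<and> h e = 1)"

end

theory Submission
  imports Defs
begin

text \<open>A graph with at most \<open>(n - 1) (n - 2) / 2\<close> edges has \<open>q(G) \<le> 2n - 4\<close>, whereas \<open>q(H) > 2n - 4\<close> for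
  \<open>H = H\<^sub>n\<^sub>,\<^sub>a\<close>; so at most \<open>n - 2\<close> pairs of vertices of \<open>G\<close> are not adjacent. If some vertex had degree below
  \<open>a\<close>, then \<open>G\<close> would be a spanning subgraph of \<open>H\<close>, and a proper one because \<open>G\<close> is not
  isomorphic to \<open>H\<close>; comparison with the positive eigenfunction of \<open>H\<close> would give \<open>q(G) < q(H)\<close>.
  Finally, a graph with minimum degree at least \<open>a\<close> and so few missing edges satisfies, after the deletion
  of any edge \<open>e\<close>, the cut condition for a fractional factor with degree \<open>a - 1\<close> at the ends of \<open>e\<close> and
  degree \<open>a\<close> elsewhere; giving \<open>e\<close> the weight \<open>1\<close> completes it.\<close>

section \<open>Spectrum and eigenfunctions\<close>

definition nbrs :: "'v graph \<Rightarrow> 'v \<Rightarrow> 'v set" where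
  "nbrs G x = {y. {x, y} \<in> edges G}"

lemma nbrs_sym: "y \<in> nbrs G x \<longleftrightarrow> x \<in> nbrs G y"
  by (simp add: nbrs_def insert_commute)

lemma simple_graph_finite: "simple_graph G \<Longrightarrow> finite (verts G)"
  by (simp add: simple_graph_def)

lemma not_in_nbrs_self: "simple_graph G \<Longrightarrow> x \<notin> nbrs G x"
  by (force simp: simple_graph_def nbrs_def)

lemma nbrs_subset: "simple_graph G \<Longrightarrow> nbrs G x \<subseteq> verts G - {x}"
  using not_in_nbrs_self by (fastforce simp: simple_graph_def nbrs_def)

lemma finite_nbrs: "simple_graph G \<Longrightarrow> finite (nbrs G x)"
  by (meson Diff_subset finite_subset nbrs_subset simple_graph_finite)

lemma edge_cases:
  assumes "simple_graph G" "e \<in> edges G"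
  obtains x y where "e = {x, y}" "x \<noteq> y" "x \<in> verts G" "y \<in> verts G" "y \<in> nbrs G x"
proof -
  from assms have "card e = 2" "e \<subseteq> verts G" by (auto simp: simple_graph_def)
  then obtain x y where "e = {x, y}" "x \<noteq> y" by (meson card_2_iff)
  with assms \<open>e \<subseteq> verts G\<close> that show ?thesis by (auto simp: nbrs_def)
qed

lemma bij_betw_nbrs_incident_edges:
  assumes "simple_graph G"
  shows "bij_betw (\<lambda>y. {x, y}) (nbrs G x) (incident_edges G x)"
proof (rule bij_betwI')
  fix e assume "e \<in> incident_edges G x"
  then have e: "e \<in> edges G" "x \<in> e" by (auto simp: incident_edges_def)
  with assms show "\<exists>y\<in>nbrs G x. e = {x, y}"
    by (elim edge_cases) (auto simp: nbrs_def insert_commute)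
qed (auto simp: nbrs_def incident_edges_def doubleton_eq_iff)

lemma vdegree_eq_card_nbrs: "simple_graph G \<Longrightarrow> vdegree G x = card (nbrs G x)"
  unfolding vdegree_def using bij_betw_nbrs_incident_edges bij_betw_same_card by metis

text \<open>An eigenvector of \<open>D + A\<close> as a function on the vertices; the second
  conjunct is one row of the eigenvalue equation. No numbering of the vertices enters.\<close>

definition eigenfunction :: "'v graph \<Rightarrow> real \<Rightarrow> ('v \<Rightarrow> real) \<Rightarrow> bool" where
  "eigenfunction G k x \<longleftrightarrow>
     (\<exists>v\<in>verts G. x v \<noteq> 0) \<and>
     (\<forall>v\<in>verts G. real (card (nbrs G v)) * x v + (\<Sum>w\<in>nbrs G v. x w) = k * x v)"

lemma vertex_enum_bij:
  assumes "simple_graph G"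
  shows "bij_betw (vertex_enum G) {..<card (verts G)} (verts G)"
  unfolding vertex_enum_def
  using ex_bij_betw_nat_finite[OF simple_graph_finite[OF assms]]
  by (metis (mono_tags, lifting) atLeast0LessThan someI_ex)

lemma signless_laplacian_carrier:
  "signless_laplacian G \<in> carrier_mat (card (verts G)) (card (verts G))"
  by (simp add: signless_laplacian_def degree_matrix_def adjacency_matrix_def)

lemma signless_laplacian_mult_vec:
  assumes G: "simple_graph G" and i: "i < card (verts G)" and dim: "dim_vec z = card (verts G)"
    and z: "\<And>j. j < card (verts G) \<Longrightarrow> z $ j = x (vertex_enum G j)"
  shows "(signless_laplacian G *\<^sub>v z) $ i =
    real (card (nbrs G (vertex_enum G i))) * x (vertex_enum G i) + (\<Sum>w\<in>nbrs G (vertex_enum G i). x w)"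
proof -
  let ?n = "card (verts G)" and ?f = "vertex_enum G"
  have bij: "bij_betw ?f {..<?n} (verts G)" by (rule vertex_enum_bij[OF G])
  have "(signless_laplacian G *\<^sub>v z) $ i = (\<Sum>j<?n. ((if i = j then real (vdegree G (?f i)) else 0) +
     (if {?f i, ?f j} \<in> edges G then 1 else 0)) * x (?f j))"
    using i dim by (simp add: signless_laplacian_def degree_matrix_def adjacency_matrix_def
        scalar_prod_def z atLeast0LessThan)
  also have "\<dots> = (\<Sum>j<?n. if i = j then real (vdegree G (?f i)) * x (?f j) else 0) +
     (\<Sum>j<?n. if {?f i, ?f j} \<in> edges G then x (?f j) else 0)"
    by (subst sum.distrib[symmetric]) (rule sum.cong, auto simp: algebra_simps)
  also have "(\<Sum>j<?n. if {?f i, ?f j} \<in> edges G then x (?f j) else 0) =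
      (\<Sum>w\<in>verts G. if {?f i, w} \<in> edges G then x w else 0)"
    by (rule sum.reindex_bij_betw[OF bij])
  also have "\<dots> = (\<Sum>w\<in>nbrs G (?f i). x w)"
    using nbrs_subset[OF G, of "?f i"] simple_graph_finite[OF G]
    by (subst sum.inter_filter[symmetric]) (auto simp: nbrs_def intro!: sum.cong)
  finally show ?thesis using i by (simp add: vdegree_eq_card_nbrs[OF G])
qed

text \<open>Vectors and functions on vertices correspond along the bijection
  \<open>vertex_enum\<close>. All later eigenvalue bounds argue with functions alone.\<close>

lemma spectrum_iff_eigenfunction:
  assumes G: "simple_graph G"
  shows "k \<in> spectrum (signless_laplacian G) \<longleftrightarrow> (\<exists>x. eigenfunction G k x)"
proof
  let ?n = "card (verts G)" and ?f = "vertex_enum G" and ?A = "signless_laplacian G"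
  have bij: "bij_betw ?f {..<?n} (verts G)" by (rule vertex_enum_bij[OF G])
  have dimr: "dim_row ?A = ?n" using signless_laplacian_carrier by blast
  {
    assume "k \<in> spectrum ?A"
    then obtain z where z: "z \<in> carrier_vec ?n" "z \<noteq> 0\<^sub>v ?n" "?A *\<^sub>v z = k \<cdot>\<^sub>v z"
      by (auto simp: spectrum_def eigenvalue_def eigenvector_def dimr)
    define x where "x v = z $ (the_inv_into {..<?n} ?f v)" for v
    have x: "x (?f j) = z $ j" if "j < ?n" for j
      using that bij by (simp add: x_def the_inv_into_f_f bij_betw_def)
    obtain j where j: "j < ?n" "z $ j \<noteq> 0" using z(1,2) by (metis carrier_vecD eq_vecI index_zero_vec)
    have ex: "\<exists>v\<in>verts G. x v \<noteq> 0"
      using x[OF j(1)] j bij by (metis bij_betwE lessThan_iff)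
    have "real (card (nbrs G v)) * x v + (\<Sum>w\<in>nbrs G v. x w) = k * x v" if "v \<in> verts G" for v
    proof -
      have "v \<in> ?f ` {..<?n}" using that bij_betw_imp_surj_on[OF bij] by simp
      then obtain i where i: "i < ?n" "v = ?f i" by (elim imageE) simp
      have "(?A *\<^sub>v z) $ i = real (card (nbrs G (?f i))) * x (?f i) + (\<Sum>w\<in>nbrs G (?f i). x w)"
        using z(1) i(1) x by (intro signless_laplacian_mult_vec[OF G]) auto
      then show ?thesis using z i x by simp
    qed
    with ex show "\<exists>x. eigenfunction G k x" unfolding eigenfunction_def by blast
  }
  {
    assume "\<exists>x. eigenfunction G k x"
    then obtain x where x: "\<exists>v\<in>verts G. x v \<noteq> 0"
      "\<And>v. v \<in> verts G \<Longrightarrow> real (card (nbrs G v)) * x v + (\<Sum>w\<in>nbrs G v. x w) = k * x v"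
      unfolding eigenfunction_def by blast
    define z where "z = vec ?n (\<lambda>i. x (?f i))"
    have "\<exists>v\<in>?f ` {..<?n}. x v \<noteq> 0"
      using x(1) bij_betw_imp_surj_on[OF bij] by simp
    then obtain i where "i < ?n" "x (?f i) \<noteq> 0" by (elim bexE imageE) simp
    then have nz: "z \<noteq> 0\<^sub>v ?n" unfolding z_def by (metis index_vec index_zero_vec(1))
    have "?A *\<^sub>v z = k \<cdot>\<^sub>v z"
    proof (rule eq_vecI)
      fix i assume "i < dim_vec (k \<cdot>\<^sub>v z)"
      then have i: "i < ?n" by (simp add: z_def)
      have "(?A *\<^sub>v z) $ i = real (card (nbrs G (?f i))) * x (?f i) + (\<Sum>w\<in>nbrs G (?f i). x w)"
        using i by (intro signless_laplacian_mult_vec[OF G]) (auto simp: z_def)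
      also have "\<dots> = k * x (?f i)" using x(2) i bij by (metis bij_betwE lessThan_iff)
      finally show "(?A *\<^sub>v z) $ i = (k \<cdot>\<^sub>v z) $ i" using i by (simp add: z_def)
    qed (simp add: dimr z_def)
    moreover have "z \<in> carrier_vec ?n" by (simp add: z_def)
    ultimately show "k \<in> spectrum ?A"
      using nz unfolding spectrum_def eigenvalue_def eigenvector_def dimr by blast
  }
qed

text \<open>A complex eigenvalue \<open>k\<close> exists. The Hermitian form of \<open>A\<close> at
  its eigenvector is \<open>k\<close> times a positive number and, by symmetry, equals its own
  conjugate; hence \<open>k\<close> is real.\<close>

lemma symmetric_real_mat_spectrum_nonempty:
  fixes A :: "real mat"
  assumes A: "A \<in> carrier_mat n n" and n: "n > 0"
    and sym: "\<And>i j. i < n \<Longrightarrow> j < n \<Longrightarrow> A $$ (i, j) = A $$ (j, i)"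
  shows "spectrum A \<noteq> {}"
proof -
  let ?B = "map_mat complex_of_real A"
  have B: "?B \<in> carrier_mat n n" using A by simp
  obtain k where k: "eigenvalue ?B k"
    using spectrum_non_empty[OF B n] by (auto simp: spectrum_def)
  then obtain z where z: "z \<in> carrier_vec n" "z \<noteq> 0\<^sub>v n" "?B *\<^sub>v z = k \<cdot>\<^sub>v z"
    using A by (auto simp: eigenvalue_def eigenvector_def)
  have row: "(\<Sum>j<n. of_real (A $$ (i, j)) * z $ j) = k * z $ i" if "i < n" for i
  proof -
    have "(?B *\<^sub>v z) $ i = (\<Sum>j<n. of_real (A $$ (i, j)) * z $ j)"
      using that z(1) A by (auto simp: scalar_prod_def atLeast0LessThan intro!: sum.cong)
    then show ?thesis using z that by simp
  qed
  define N where "N = (\<Sum>i<n. (cmod (z $ i))\<^sup>2)"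
  define S where "S = (\<Sum>i<n. \<Sum>j<n. cnj (z $ i) * of_real (A $$ (i, j)) * z $ j)"
  have "S = (\<Sum>i<n. cnj (z $ i) * (k * z $ i))"
    unfolding S_def by (intro sum.cong refl) (simp add: row[symmetric] sum_distrib_left mult.assoc)
  also have "\<dots> = (\<Sum>i<n. k * of_real ((cmod (z $ i))\<^sup>2))"
    by (intro sum.cong refl) (simp only: complex_norm_square mult_ac)
  also have "\<dots> = k * of_real N"
    by (simp add: N_def sum_distrib_left)
  finally have S: "S = k * of_real N" .
  have "cnj S = (\<Sum>i<n. \<Sum>j<n. z $ i * of_real (A $$ (i, j)) * cnj (z $ j))"
    by (simp add: S_def)
  also have "\<dots> = (\<Sum>i<n. \<Sum>j<n. z $ j * of_real (A $$ (j, i)) * cnj (z $ i))"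
    by (rule sum.swap)
  also have "\<dots> = S" unfolding S_def using sym by (intro sum.cong refl) (simp add: mult_ac)
  finally have "cnj k * of_real N = k * of_real N" using S by simp
  moreover have "N > 0"
  proof -
    obtain j where "j < n" "z $ j \<noteq> 0" using z(1,2) by (metis carrier_vecD eq_vecI index_zero_vec)
    then show ?thesis unfolding N_def by (intro sum_pos2[of _ j]) auto
  qed
  ultimately have "cnj k = k" by simp
  then have kr: "k = of_real (Re k)" by (simp add: complex_eq_iff)
  have "poly (char_poly ?B) k = 0" using k eigenvalue_root_char_poly[OF B] by blast
  then have "poly (map_poly of_real (char_poly A)) (complex_of_real (Re k)) = 0"
    using of_real_hom.char_poly_hom[OF A] kr by metis
  then have "poly (char_poly A) (Re k) = 0" by simp
  then have "eigenvalue A (Re k)" using eigenvalue_root_char_poly[OF A] by blast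
  then show ?thesis by (auto simp: spectrum_def)
qed

text \<open>The spectrum is finite and nonempty, so its \<open>Max\<close> is attained: the radius
  is itself an eigenvalue.\<close>

lemma signless_laplacian_radius_eigenfunction:
  assumes G: "simple_graph G" and "verts G \<noteq> {}"
  obtains x where "eigenfunction G (signless_laplacian_radius G) x"
proof -
  have "spectrum (signless_laplacian G) \<noteq> {}"
  proof (rule symmetric_real_mat_spectrum_nonempty[OF signless_laplacian_carrier])
    show "card (verts G) > 0" using assms by (simp add: simple_graph_finite card_gt_0_iff)
  qed (auto simp: signless_laplacian_def degree_matrix_def adjacency_matrix_def insert_commute)
  then have "signless_laplacian_radius G \<in> spectrum (signless_laplacian G)"
    unfolding signless_laplacian_radius_def
    using card_finite_spectrum(1)[OF signless_laplacian_carrier] by (intro Max_in)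
  then show ?thesis using that by (auto simp: spectrum_iff_eigenfunction[OF G])
qed

lemma eigenfunction_le_signless_laplacian_radius:
  assumes "simple_graph G" and "eigenfunction G k x"
  shows "k \<le> signless_laplacian_radius G"
  unfolding signless_laplacian_radius_def
  using assms card_finite_spectrum(1)[OF signless_laplacian_carrier]
  by (auto simp: spectrum_iff_eigenfunction intro!: Max_ge)

section \<open>Fractional factors\<close>

lemma sum_card_filter_eq:
  fixes E :: "('a \<times> 'b) set"
  assumes "finite X" "finite Y" "E \<subseteq> X \<times> Y"
  shows "(\<Sum>x\<in>X. card {y. (x, y) \<in> E}) = card E" and "(\<Sum>y\<in>Y. card {x. (x, y) \<in> E}) = card E"
proof -
  have fin: "finite E" using assms by (meson finite_SigmaI finite_subset)
  have "E = Sigma X (\<lambda>x. {y. (x, y) \<in> E})" using assms(3) by auto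
  moreover have "finite {y. (x, y) \<in> E}" for x
    by (rule finite_subset[OF _ assms(2)]) (use assms(3) in auto)
  ultimately have "card E = (\<Sum>x\<in>X. card {y. (x, y) \<in> E})"
    using assms(1) card_SigmaI[of X "\<lambda>x. {y. (x, y) \<in> E}"] by simp
  then show "(\<Sum>x\<in>X. card {y. (x, y) \<in> E}) = card E" by simp
  have "E\<inverse> = Sigma Y (\<lambda>y. {x. (x, y) \<in> E})" using assms(3) by auto
  moreover have "finite {x. (x, y) \<in> E}" for y
    by (rule finite_subset[OF _ assms(1)]) (use assms(3) in auto)
  ultimately have "card (E\<inverse>) = (\<Sum>y\<in>Y. card {x. (x, y) \<in> E})"
    using assms(2) card_SigmaI[of Y "\<lambda>y. {x. (x, y) \<in> E}"] by simp
  then show "(\<Sum>y\<in>Y. card {x. (x, y) \<in> E}) = card E" by simp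
qed

text \<open>As in Rado's proof of Hall's theorem, a minimal relation satisfying the cut condition is
  already regular: every pair lies in a tight cut, and by submodularity the tight cuts through one
  row can be merged into a single one, which that row then cannot violate.\<close>

theorem bipartite_degree_realization:
  fixes E :: "('a \<times> 'b) set" and f :: "'a \<Rightarrow> nat" and g :: "'b \<Rightarrow> nat"
  assumes X: "finite X" and Y: "finite Y" and EXY: "E \<subseteq> X \<times> Y"
    and total: "sum f X = sum g Y"
    and cut: "\<And>R D. R \<subseteq> X \<Longrightarrow> D \<subseteq> Y \<Longrightarrow> sum f R + sum g D \<le> sum g Y + card (E \<inter> R \<times> D)"
  shows "\<exists>M \<subseteq> E. (\<forall>x\<in>X. card {y. (x, y) \<in> M} = f x) \<and> (\<forall>y\<in>Y. card {x. (x, y) \<in> M} = g y)"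
proof -
  define P where "P M \<longleftrightarrow> M \<subseteq> E \<and>
    (\<forall>R D. R \<subseteq> X \<longrightarrow> D \<subseteq> Y \<longrightarrow> sum f R + sum g D \<le> sum g Y + card (M \<inter> R \<times> D))" for M
  have finE: "finite E" using X Y EXY by (meson finite_SigmaI finite_subset)
  have "finite (Collect P)" by (rule finite_subset[of _ "Pow E"]) (auto simp: P_def finE)
  moreover have "E \<in> Collect P" using cut by (simp add: P_def)
  ultimately obtain M where PM: "P M" and min: "\<And>N. P N \<Longrightarrow> N \<subseteq> M \<Longrightarrow> N = M"
    using finite_has_minimal2[of "Collect P" E] by blast
  have ME: "M \<subseteq> E" and Mcut: "\<And>R D. R \<subseteq> X \<Longrightarrow> D \<subseteq> Y \<Longrightarrow> sum f R + sum g D \<le> sum g Y + card (M \<inter> R \<times> D)"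
    using PM unfolding P_def by blast+
  have MXY: "M \<subseteq> X \<times> Y" using ME EXY by blast
  have finM: "finite M" using ME finE finite_subset by blast
  define tight where "tight R D \<longleftrightarrow> R \<subseteq> X \<and> D \<subseteq> Y \<and> sum f R + sum g D = sum g Y + card (M \<inter> R \<times> D)" for R D
  have edge_tight: "\<exists>R D. tight R D \<and> u \<in> R \<and> v \<in> D" if uv: "(u, v) \<in> M" for u v
  proof -
    \<comment> \<open>By minimality, deleting the pair violates some cut. Its count drops by at most
      one, so that cut contains the pair and is tight for \<open>M\<close>.\<close>
    have "\<not> P (M - {(u, v)})" using min[of "M - {(u, v)}"] uv by blast
    then obtain R D where RD: "R \<subseteq> X" "D \<subseteq> Y"
      and lt: "sum f R + sum g D > sum g Y + card ((M - {(u, v)}) \<inter> R \<times> D)"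
      using ME unfolding P_def by (meson Diff_subset not_le subset_trans)
    have mem: "(u, v) \<in> M \<inter> R \<times> D"
    proof (rule ccontr)
      assume "(u, v) \<notin> M \<inter> R \<times> D"
      then have "(M - {(u, v)}) \<inter> R \<times> D = M \<inter> R \<times> D" by auto
      with lt Mcut[OF RD] show False by simp
    qed
    have "(M - {(u, v)}) \<inter> R \<times> D = (M \<inter> R \<times> D) - {(u, v)}" by auto
    then have "Suc (card ((M - {(u, v)}) \<inter> R \<times> D)) = card (M \<inter> R \<times> D)"
      using card_Suc_Diff1[OF _ mem] finM by simp
    with lt Mcut[OF RD] RD mem show ?thesis unfolding tight_def by (intro exI[of _ R] exI[of _ D]) auto
  qed
  have merge: "tight (R1 \<inter> R2) (D1 \<union> D2)" if t: "tight R1 D1" "tight R2 D2" for R1 R2 D1 D2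
  proof -
    have sub: "R1 \<subseteq> X" "R2 \<subseteq> X" "D1 \<subseteq> Y" "D2 \<subseteq> Y" using t by (auto simp: tight_def)
    then have fin: "finite R1" "finite R2" "finite D1" "finite D2" using X Y finite_subset by blast+
    have f: "sum f (R1 \<union> R2) + sum f (R1 \<inter> R2) = sum f R1 + sum f R2"
      using fin by (simp add: sum.union_inter)
    have g: "sum g (D1 \<union> D2) + sum g (D1 \<inter> D2) = sum g D1 + sum g D2"
      using fin by (simp add: sum.union_inter)
    let ?A = "M \<inter> R1 \<times> D1" and ?B = "M \<inter> R2 \<times> D2"
    let ?C = "M \<inter> (R1 \<union> R2) \<times> (D1 \<inter> D2)" and ?D = "M \<inter> (R1 \<inter> R2) \<times> (D1 \<union> D2)"
    \<comment> \<open>Uncrossing: \<open>?C\<close> and \<open>?D\<close> together lie in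
      \<open>?A \<union> ?B\<close>, and a pair in both lies in \<open>?A \<inter> ?B\<close>. The
      left-hand sides of the cuts are modular, so equality is forced in both new cuts.\<close>
    have "card ?C + card ?D = card (?C \<union> ?D) + card (?C \<inter> ?D)" by (rule card_Un_Int) (use finM in auto)
    also have "\<dots> \<le> card (?A \<union> ?B) + card (?A \<inter> ?B)"
      using finM by (intro add_mono card_mono) auto
    also have "\<dots> = card ?A + card ?B" by (rule card_Un_Int[symmetric]) (use finM in auto)
    finally have "card ?C + card ?D \<le> card ?A + card ?B" .
    moreover have "sum f (R1 \<union> R2) + sum g (D1 \<inter> D2) \<le> sum g Y + card ?C"
      by (rule Mcut) (use sub in auto)
    moreover have "sum f (R1 \<inter> R2) + sum g (D1 \<union> D2) \<le> sum g Y + card ?D"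
      by (rule Mcut) (use sub in auto)
    ultimately have "sum f (R1 \<inter> R2) + sum g (D1 \<union> D2) = sum g Y + card ?D"
      using t f g unfolding tight_def by linarith
    then show ?thesis using sub by (auto simp: tight_def)
  qed
  have finrow: "finite {y. (x, y) \<in> M}" for x
    by (rule finite_subset[OF _ Y]) (use MXY in auto)
  have row_le: "card {y. (u, y) \<in> M} \<le> f u" if u: "u \<in> X" for u
  proof (cases "{y. (u, y) \<in> M} = {}")
    case False
    have "\<exists>R D. tight R D \<and> u \<in> R \<and> N \<subseteq> D"
      if "finite N" "N \<noteq> {}" "N \<subseteq> {y. (u, y) \<in> M}" for N
      using that
    proof (induction rule: finite_ne_induct)
      case (singleton v)
      then show ?case using edge_tight by auto
    next
      case (insert v N)
      then obtain R D where "tight R D" "u \<in> R" "N \<subseteq> D" by auto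
      moreover obtain R' D' where "tight R' D'" "u \<in> R'" "v \<in> D'" using edge_tight[of u v] insert.prems by auto
      ultimately show ?case using merge by (intro exI[of _ "R \<inter> R'"] exI[of _ "D \<union> D'"]) auto
    qed
    from this[OF finrow False] obtain R D where RD: "tight R D" "u \<in> R" "{y. (u, y) \<in> M} \<subseteq> D" by auto
    then have sub: "R \<subseteq> X" "D \<subseteq> Y" by (auto simp: tight_def)
    \<comment> \<open>As \<open>D\<close> contains the whole row of \<open>u\<close>, removing
      \<open>u\<close> from \<open>R\<close> costs exactly that row on the right and
      \<open>f u\<close> on the left; the cut condition for \<open>R - {u}\<close> then bounds the
      row by \<open>f u\<close>.\<close>
    have "M \<inter> R \<times> D = (M \<inter> (R - {u}) \<times> D) \<union> Pair u ` {y. (u, y) \<in> M}" using RD by auto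
    moreover have "card (Pair u ` {y. (u, y) \<in> M}) = card {y. (u, y) \<in> M}"
      by (rule card_image) (auto simp: inj_on_def)
    ultimately have "card (M \<inter> R \<times> D) = card (M \<inter> (R - {u}) \<times> D) + card {y. (u, y) \<in> M}"
      using finM finrow by (simp only: ) (subst card_Un_disjoint, auto)
    moreover have "sum f R = f u + sum f (R - {u})"
      using RD(2) sub X by (meson finite_subset sum.remove)
    moreover have "sum f (R - {u}) + sum g D \<le> sum g Y + card (M \<inter> (R - {u}) \<times> D)"
      by (rule Mcut) (use sub in auto)
    ultimately show ?thesis using RD(1) unfolding tight_def by linarith
  qed simp
  have row_ge: "f u \<le> card {y. (u, y) \<in> M}" if u: "u \<in> X" for u
  proof -
    have "M \<inter> {u} \<times> Y = Pair u ` {y. (u, y) \<in> M}" using MXY by auto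
    moreover have "card (Pair u ` {y. (u, y) \<in> M}) = card {y. (u, y) \<in> M}"
      by (rule card_image) (auto simp: inj_on_def)
    ultimately show ?thesis using Mcut[of "{u}" Y] u by simp
  qed
  have row: "card {y. (x, y) \<in> M} = f x" if "x \<in> X" for x
    using row_le row_ge that by (simp add: le_antisym)
  have col_ge: "g v \<le> card {x. (x, v) \<in> M}" if v: "v \<in> Y" for v
  proof -
    have "M \<inter> X \<times> {v} = (\<lambda>x. (x, v)) ` {x. (x, v) \<in> M}" using MXY by auto
    moreover have "card ((\<lambda>x. (x, v)) ` {x. (x, v) \<in> M}) = card {x. (x, v) \<in> M}"
      by (rule card_image) (auto simp: inj_on_def)
    ultimately show ?thesis using Mcut[of X "{v}"] v total by simp
  qed
  \<comment> \<open>The column counts dominate \<open>g\<close> termwise and have the same total, so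
    they agree with \<open>g\<close>.\<close>
  have "(\<Sum>y\<in>Y. card {x. (x, y) \<in> M}) = sum g Y"
    using sum_card_filter_eq[OF X Y MXY] row total by simp
  then have "card {x. (x, y) \<in> M} = g y" if "y \<in> Y" for y
    using col_ge that sum_mono_inv[of g Y "\<lambda>y. card {x. (x, y) \<in> M}"] Y by metis
  with row ME show ?thesis by blast
qed

text \<open>The degrees of a subset of the ordered adjacent pairs become those of a half-integral weighting
  of the edges once the two orientations of each edge are averaged.\<close>

theorem fractional_factor_criterion:
  assumes G: "simple_graph G"
    and crit: "\<And>S T. S \<subseteq> verts G \<Longrightarrow> T \<subseteq> verts G \<Longrightarrow> S \<inter> T = {} \<Longrightarrow>
      sum f T \<le> sum f S + (\<Sum>x\<in>T. card (nbrs G x - S))"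
  shows "\<exists>h :: 'v set \<Rightarrow> real. (\<forall>e\<in>edges G. 0 \<le> h e \<and> h e \<le> 1) \<and>
    (\<forall>x\<in>verts G. (\<Sum>e\<in>incident_edges G x. h e) = real (f x))"
proof -
  let ?V = "verts G"
  have V: "finite ?V" using G by (rule simple_graph_finite)
  define E where "E = {(x, y). y \<in> nbrs G x}"
  have EV: "E \<subseteq> ?V \<times> ?V" using nbrs_subset[OF G] nbrs_sym by (fastforce simp: E_def)
  have finE: "finite E" using V EV by (meson finite_SigmaI finite_subset)
  have "\<exists>M \<subseteq> E. (\<forall>x\<in>?V. card {y. (x, y) \<in> M} = f x) \<and> (\<forall>y\<in>?V. card {x. (x, y) \<in> M} = f y)"
  proof (rule bipartite_degree_realization[OF V V EV refl])
    fix R D assume R: "R \<subseteq> ?V" and D: "D \<subseteq> ?V"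
    \<comment> \<open>Vertices in both \<open>R\<close> and \<open>D\<close> are counted twice on
      the left, those in neither only on the right; after cancellation the cut inequality is the
      criterion for these \<open>T\<close> and \<open>S\<close>, up to comparing the two counts of
      pairs.\<close>
    define T where "T = R \<inter> D"
    define S where "S = ?V - (R \<union> D)"
    have fin: "finite R" "finite D" "finite T"
      using R D V by (auto simp: T_def intro: finite_subset)
    have sums: "sum f R + sum f D = sum f (R \<union> D) + sum f T"
      using fin by (simp add: T_def sum.union_inter)
    have fV: "sum f ?V = sum f (R \<union> D) + sum f S"
      unfolding S_def using R D V by (metis Un_least add.commute sum.subset_diff)
    \<comment> \<open>A pair \<open>(x, y)\<close> with \<open>x \<in> T\<close> and
      \<open>y \<notin> S\<close> has \<open>y\<close> in \<open>D\<close> or in \<open>R\<close>;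
      it is kept or reversed so as to lie in \<open>R \<times> D\<close>. A kept and a reversed pair
      never collide, since the second entry of a reversed pair is reversed only if its neighbour
      lies outside \<open>D\<close>, while \<open>T \<subseteq> D\<close>.\<close>
    define j where "j = (\<lambda>(x, y). if y \<in> D then (x, y) else (y, x))"
    have "(\<Sum>x\<in>T. card (nbrs G x - S)) = card (Sigma T (\<lambda>x. nbrs G x - S))"
      using fin finite_nbrs[OF G] by simp
    also have "\<dots> \<le> card (E \<inter> R \<times> D)"
    proof (rule card_inj_on_le)
      show "inj_on j (Sigma T (\<lambda>x. nbrs G x - S))"
        by (auto simp: inj_on_def j_def T_def split: if_splits)
      show "j ` (Sigma T (\<lambda>x. nbrs G x - S)) \<subseteq> E \<inter> R \<times> D"
      proof
        fix p assume "p \<in> j ` (Sigma T (\<lambda>x. nbrs G x - S))"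
        then obtain x y where xy: "x \<in> T" "y \<in> nbrs G x" "y \<notin> S" "p = j (x, y)" by auto
        moreover have "y \<in> ?V" using xy(2) nbrs_subset[OF G] by blast
        moreover have "x \<in> nbrs G y" using xy(2) nbrs_sym by metis
        ultimately show "p \<in> E \<inter> R \<times> D" by (auto simp: j_def T_def S_def E_def)
      qed
      show "finite (E \<inter> R \<times> D)" using finE by simp
    qed
    finally have "(\<Sum>x\<in>T. card (nbrs G x - S)) \<le> card (E \<inter> R \<times> D)" .
    moreover have "sum f T \<le> sum f S + (\<Sum>x\<in>T. card (nbrs G x - S))"
      by (rule crit) (use R in \<open>auto simp: S_def T_def\<close>)
    ultimately show "sum f R + sum f D \<le> sum f ?V + card (E \<inter> R \<times> D)"
      using sums fV by linarith
  qed
  then obtain M where M: "M \<subseteq> E" and row: "\<And>x. x \<in> ?V \<Longrightarrow> card {y. (x, y) \<in> M} = f x"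
    and col: "\<And>y. y \<in> ?V \<Longrightarrow> card {x. (x, y) \<in> M} = f y" by blast
  have finM: "finite M" using M finE finite_subset by blast
  define h :: "'v set \<Rightarrow> real" where "h e = real (card {(x, y) \<in> M. e = {x, y}}) / 2" for e
  have h: "h {x, y} = (of_bool ((x, y) \<in> M) + of_bool ((y, x) \<in> M)) / 2" if "x \<noteq> y" for x y
  proof -
    have "{(u, v) \<in> M. {x, y} = {u, v}} =
      (if (x, y) \<in> M then {(x, y)} else {}) \<union> (if (y, x) \<in> M then {(y, x)} else {})"
      by (auto simp: doubleton_eq_iff)
    then show ?thesis using that unfolding h_def by simp
  qed
  have bounds: "0 \<le> h e \<and> h e \<le> 1" if e: "e \<in> edges G" for e
  proof -
    obtain x y where "e = {x, y}" "x \<noteq> y" using edge_cases[OF G e] by metis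
    then show ?thesis
      by (cases "(x, y) \<in> M"; cases "(y, x) \<in> M") (auto simp: h)
  qed
  have "(\<Sum>e\<in>incident_edges G x. h e) = real (f x)" if x: "x \<in> ?V" for x
  proof -
    have N: "{y. (x, y) \<in> M} = {y \<in> nbrs G x. (x, y) \<in> M}" "{y. (y, x) \<in> M} = {y \<in> nbrs G x. (y, x) \<in> M}"
      using M nbrs_sym by (fastforce simp: E_def)+
    have "(\<Sum>e\<in>incident_edges G x. h e) = (\<Sum>y\<in>nbrs G x. h {x, y})"
      by (rule sum.reindex_bij_betw[OF bij_betw_nbrs_incident_edges[OF G], symmetric])
    also have "\<dots> = (\<Sum>y\<in>nbrs G x. (of_bool ((x, y) \<in> M) + of_bool ((y, x) \<in> M)) / 2)"
      using not_in_nbrs_self[OF G] by (intro sum.cong refl h) metis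
    also have "\<dots> = (real (card {y \<in> nbrs G x. (x, y) \<in> M}) + real (card {y \<in> nbrs G x. (y, x) \<in> M})) / 2"
      using finite_nbrs[OF G, of x]
      by (simp add: sum_divide_distrib[symmetric] sum.distrib of_bool_def sum.If_cases Int_def)
    also have "\<dots> = real (f x)" using row[OF x] col[OF x] N by simp
    finally show ?thesis .
  qed
  with bounds show ?thesis by blast
qed

section \<open>Eigenvalue bounds\<close>

lemma nbrs_mono: "edges G \<subseteq> edges K \<Longrightarrow> nbrs G x \<subseteq> nbrs K x"
  by (auto simp: nbrs_def)

lemma card_nbrs_le: "simple_graph G \<Longrightarrow> x \<in> verts G \<Longrightarrow> card (nbrs G x) \<le> card (verts G) - 1"
  using card_mono[OF _ nbrs_subset, of G x] by (simp add: simple_graph_finite)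

text \<open>Symmetry of the adjacency form: it lets the operator be moved from one function of a
  pairing to the other.\<close>

lemma sum_nbrs_swap:
  fixes y z :: "'v \<Rightarrow> real"
  assumes "simple_graph G"
  shows "(\<Sum>v\<in>verts G. y v * (\<Sum>w\<in>nbrs G v. z w)) = (\<Sum>v\<in>verts G. z v * (\<Sum>w\<in>nbrs G v. y w))"
proof -
  have e: "nbrs G v = {w \<in> verts G. {v, w} \<in> edges G}" for v
    using nbrs_subset[OF assms, of v] by (auto simp: nbrs_def)
  have fin: "finite (verts G)" using assms by (rule simple_graph_finite)
  have c: "(\<Sum>v\<in>verts G. a v * (\<Sum>w\<in>nbrs G v. b w)) =
      (\<Sum>v\<in>verts G. \<Sum>w\<in>verts G. if {v, w} \<in> edges G then a v * b w else 0)" for a b :: "'v \<Rightarrow> real"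
    by (intro sum.cong refl) (simp add: e sum.inter_filter[OF fin] sum_distrib_left if_distrib cong: if_cong)
  have "(\<Sum>v\<in>verts G. y v * (\<Sum>w\<in>nbrs G v. z w)) =
      (\<Sum>w\<in>verts G. \<Sum>v\<in>verts G. if {v, w} \<in> edges G then y v * z w else 0)"
    unfolding c by (rule sum.swap)
  also have "\<dots> = (\<Sum>v\<in>verts G. z v * (\<Sum>w\<in>nbrs G v. y w))"
    unfolding c by (intro sum.cong refl) (auto simp: insert_commute mult.commute)
  finally show ?thesis .
qed

text \<open>Pairing \<open>\<bar>x\<bar>\<close> with the positive eigenfunction of the larger graph gives the inequality. In the case
  of equality \<open>\<bar>x\<bar>\<close> would be an eigenfunction of the larger graph vanishing at the ends of every
  edge lost, and the zero would spread to all vertices through the dominating vertex.\<close>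

lemma eigenvalue_proper_subgraph_less:
  assumes G: "simple_graph G" and K: "simple_graph K" and V: "verts G = verts K"
    and sub: "edges G \<subset> edges K"
    and c: "c \<in> verts K" "verts K - {c} \<subseteq> nbrs K c"
    and y: "eigenfunction K \<theta> y" and pos: "\<And>v. v \<in> verts K \<Longrightarrow> y v > 0"
    and x: "eigenfunction G k x"
  shows "k < \<theta>"
proof (rule ccontr)
  assume "\<not> k < \<theta>"
  then have k: "k \<ge> \<theta>" by simp
  let ?V = "verts K"
  have fin: "finite ?V" using K by (rule simple_graph_finite)
  define z where "z v = \<bar>x v\<bar>" for v
  define QG where "QG v = real (card (nbrs G v)) * z v + (\<Sum>w\<in>nbrs G v. z w)" for v
  define QK where "QK v = real (card (nbrs K v)) * z v + (\<Sum>w\<in>nbrs K v. z w)" for v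
  have z0: "z v \<ge> 0" for v by (simp add: z_def)
  have NM: "nbrs G v \<subseteq> nbrs K v" for v using sub by (intro nbrs_mono) auto
  have GK: "QG v \<le> QK v" for v
    unfolding QG_def QK_def using NM finite_nbrs[OF K] z0
    by (intro add_mono mult_right_mono sum_mono2) (auto intro: card_mono)
  have up: "k * z v \<le> QG v" if "v \<in> ?V" for v
  proof -
    have "k * z v \<le> \<bar>k * x v\<bar>" by (simp add: z_def abs_mult mult_right_mono)
    also have "\<dots> = \<bar>real (card (nbrs G v)) * x v + (\<Sum>w\<in>nbrs G v. x w)\<bar>"
      using x that by (simp add: eigenfunction_def V)
    also have "\<dots> \<le> \<bar>real (card (nbrs G v)) * x v\<bar> + \<bar>\<Sum>w\<in>nbrs G v. x w\<bar>" by (rule abs_triangle_ineq)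
    also have "\<dots> \<le> QG v" unfolding QG_def z_def using sum_abs[of x "nbrs G v"] by (simp add: abs_mult)
    finally show ?thesis .
  qed
  \<comment> \<open>Moved onto \<open>y\<close>, the operator of \<open>K\<close> is multiplication
    by \<open>\<theta>\<close>. Together with \<open>up\<close> and \<open>GK\<close> this squeezes
    \<open>QK\<close> between \<open>k * z\<close> pointwise and \<open>k * z\<close> on
    average.\<close>
  have "(\<Sum>v\<in>?V. y v * QK v) =
      (\<Sum>v\<in>?V. z v * (real (card (nbrs K v)) * y v + (\<Sum>w\<in>nbrs K v. y w)))"
    unfolding QK_def using sum_nbrs_swap[OF K, of y z]
    by (simp add: distrib_left sum.distrib mult_ac)
  also have "\<dots> = (\<Sum>v\<in>?V. y v * (\<theta> * z v))"
    using y by (intro sum.cong refl) (simp add: eigenfunction_def mult_ac)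
  also have "\<dots> \<le> (\<Sum>v\<in>?V. y v * (k * z v))"
    using pos z0 k by (intro sum_mono mult_left_mono mult_right_mono) (auto simp: less_imp_le)
  finally have le: "(\<Sum>v\<in>?V. y v * QK v) \<le> (\<Sum>v\<in>?V. y v * (k * z v))" .
  have "(\<Sum>v\<in>?V. y v * (QK v - k * z v)) \<le> 0"
    using le by (simp add: right_diff_distrib sum_subtractf)
  moreover have nonneg: "y v * (QK v - k * z v) \<ge> 0" if "v \<in> ?V" for v
    using up[OF that] GK[of v] pos[OF that] by simp
  ultimately have "(\<Sum>v\<in>?V. y v * (QK v - k * z v)) = 0" by (meson antisym sum_nonneg)
  then have "\<forall>v\<in>?V. y v * (QK v - k * z v) = 0"
    using sum_nonneg_eq_0_iff[OF fin, of "\<lambda>v. y v * (QK v - k * z v)"] nonneg by blast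
  then have eq: "QK v = k * z v" if "v \<in> ?V" for v
    using that pos[OF that] by (metis eq_iff_diff_eq_0 less_irrefl mult_eq_0_iff)
  have spread: "z w = 0" if "v \<in> ?V" "z v = 0" "w \<in> nbrs K v" for v w
  proof -
    have "(\<Sum>w\<in>nbrs K v. z w) = 0" using eq[OF that(1)] that(2) by (simp add: QK_def)
    then show ?thesis using sum_nonneg_eq_0_iff[OF finite_nbrs[OF K], of v z] z0 that(3) by auto
  qed
  obtain e where e: "e \<in> edges K" "e \<notin> edges G" using sub by blast
  then obtain u w where uw: "u \<in> ?V" "w \<in> nbrs K u" "w \<notin> nbrs G u"
    using edge_cases[OF K, of e] by (metis mem_Collect_eq nbrs_def)
  have "z u = 0"
  proof -
    \<comment> \<open>From \<open>K\<close> to \<open>G\<close> the degree of \<open>u\<close> drops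
      and the neighbour sum does not grow, so \<open>QG u = QK u\<close> is possible only with
      \<open>z u = 0\<close>.\<close>
    have "nbrs G u \<subset> nbrs K u" using NM uw by blast
    then have "card (nbrs G u) < card (nbrs K u)" using finite_nbrs[OF K] psubset_card_mono by blast
    moreover have "(\<Sum>w\<in>nbrs G u. z w) \<le> (\<Sum>w\<in>nbrs K u. z w)"
      using NM finite_nbrs[OF K] z0 by (intro sum_mono2) auto
    moreover have "QG u = QK u" using up[OF uw(1)] eq[OF uw(1)] GK[of u] by linarith
    ultimately have "real (card (nbrs K u)) * z u \<le> real (card (nbrs G u)) * z u"
      unfolding QG_def QK_def by linarith
    then show ?thesis
      using \<open>card (nbrs G u) < card (nbrs K u)\<close> z0[of u]
      by (metis antisym mult_le_cancel_right not_less of_nat_le_iff)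
  qed
  have "z c = 0"
  proof (cases "u = c")
    case False
    then have "c \<in> nbrs K u" using c uw(1) nbrs_sym by fast
    then show ?thesis using spread uw(1) \<open>z u = 0\<close> by blast
  qed (use \<open>z u = 0\<close> in simp)
  then have "z v = 0" if "v \<in> ?V" for v using c spread that by blast
  then show False using x by (auto simp: eigenfunction_def V z_def)
qed

text \<open>Row sums after conjugation with the degree matrix: an eigenvalue is at most the maximum over the
  vertices of the degree plus the mean degree of the neighbours.\<close>

lemma eigenvalue_le_of_few_edges:
  assumes G: "simple_graph G" and n: "card (verts G) = n" "n \<ge> 3"
    and m: "(\<Sum>v\<in>verts G. card (nbrs G v)) \<le> (n - 1) * (n - 2)"
    and x: "eigenfunction G k x"
  shows "k \<le> 2 * real n - 4"
proof (rule ccontr)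
  assume big: "\<not> k \<le> 2 * real n - 4"
  then have k: "k > 0" using n by linarith
  let ?V = "verts G" and ?d = "\<lambda>v. real (card (nbrs G v))"
  have fin: "finite ?V" using G by (rule simple_graph_finite)
  have ev: "?d v * x v + (\<Sum>w\<in>nbrs G v. x w) = k * x v" if "v \<in> ?V" for v
    using x that by (auto simp: eigenfunction_def)
  have sub: "nbrs G v \<subseteq> ?V" for v using nbrs_subset[OF G] by blast
  define W where "W = {v \<in> ?V. nbrs G v \<noteq> {}}"
  \<comment> \<open>Since \<open>k > 0\<close>, the function vanishes at isolated vertices, so the
    quotients by the degree may be restricted to \<open>W\<close>.\<close>
  have isolated: "x v = 0" if "v \<in> ?V" "nbrs G v = {}" for v using ev[OF that(1)] that(2) k by simp
  obtain v0 where v0: "v0 \<in> ?V" "x v0 \<noteq> 0" using x by (auto simp: eigenfunction_def)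
  then have "v0 \<in> W" using isolated by (auto simp: W_def)
  have dpos: "?d v > 0" if "v \<in> W" for v
    using that finite_nbrs[OF G] by (auto simp: W_def card_gt_0_iff)
  define r where "r = Max ((\<lambda>v. \<bar>x v\<bar> / ?d v) ` W)"
  have finW: "finite W" using fin by (simp add: W_def)
  have "r \<in> (\<lambda>v. \<bar>x v\<bar> / ?d v) ` W" unfolding r_def using finW \<open>v0 \<in> W\<close> by (intro Max_in) auto
  then obtain u where u: "u \<in> W" "r = \<bar>x u\<bar> / ?d u" by blast
  have r: "\<bar>x v\<bar> \<le> r * ?d v" if "v \<in> W" for v
  proof -
    have "\<bar>x v\<bar> / ?d v \<le> r" unfolding r_def using finW that by (intro Max_ge) auto
    then show ?thesis using dpos[OF that] by (simp add: divide_le_eq)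
  qed
  have rpos: "r > 0"
  proof -
    have "0 < r * ?d v0" using r[OF \<open>v0 \<in> W\<close>] v0 by linarith
    then show ?thesis using dpos[OF \<open>v0 \<in> W\<close>] by (simp add: zero_less_mult_iff)
  qed
  have uV: "u \<in> ?V" using u by (simp add: W_def)
  let ?s = "\<Sum>w\<in>nbrs G u. ?d w"
  have "k * \<bar>x u\<bar> = \<bar>?d u * x u + (\<Sum>w\<in>nbrs G u. x w)\<bar>" using ev[OF uV] k by (simp add: abs_mult)
  also have "\<dots> \<le> ?d u * \<bar>x u\<bar> + (\<Sum>w\<in>nbrs G u. \<bar>x w\<bar>)"
  proof -
    have "\<bar>\<Sum>w\<in>nbrs G u. x w\<bar> \<le> (\<Sum>w\<in>nbrs G u. \<bar>x w\<bar>)" by (rule sum_abs)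
    moreover have "\<bar>?d u * x u\<bar> = ?d u * \<bar>x u\<bar>" by (simp add: abs_mult)
    ultimately show ?thesis by linarith
  qed
  also have "(\<Sum>w\<in>nbrs G u. \<bar>x w\<bar>) \<le> (\<Sum>w\<in>nbrs G u. r * ?d w)"
  proof (rule sum_mono)
    fix w assume "w \<in> nbrs G u"
    then have "w \<in> W" using sub nbrs_sym by (fastforce simp: W_def)
    then show "\<bar>x w\<bar> \<le> r * ?d w" by (rule r)
  qed
  also have "\<dots> = r * ?s" by (simp add: sum_distrib_left)
  finally have "k * \<bar>x u\<bar> \<le> ?d u * \<bar>x u\<bar> + r * ?s" by simp
  moreover have "\<bar>x u\<bar> = r * ?d u" using u dpos[OF u(1)] by simp
  ultimately have "r * (k * ?d u) \<le> r * (?d u * ?d u + ?s)" by (simp add: algebra_simps)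
  then have main: "k * ?d u \<le> ?d u * ?d u + ?s" using rpos by simp
  have s1: "?s \<le> ?d u * (real n - 1)"
  proof -
    have "card (nbrs G w) \<le> n - 1" if "w \<in> nbrs G u" for w
      using card_nbrs_le[OF G, of w] sub n that by blast
    then have "?s \<le> (\<Sum>w\<in>nbrs G u. real n - 1)"
      using n by (intro sum_mono) (metis (no_types, lifting) of_nat_1 of_nat_diff of_nat_le_iff one_le_numeral order_trans)
    then show ?thesis by simp
  qed
  have total: "(\<Sum>v\<in>?V. ?d v) \<le> (real n - 1) * (real n - 2)"
  proof -
    have "real (\<Sum>v\<in>?V. card (nbrs G v)) \<le> real ((n - 1) * (n - 2))" using m of_nat_le_iff by blast
    then show ?thesis using n by (simp add: of_nat_diff)
  qed
  have du: "card (nbrs G u) \<le> n - 1"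
    using card_nbrs_le[OF G uV] n by simp
  \<comment> \<open>The crude bound \<open>s1\<close> suffices up to degree \<open>n - 3\<close>.
    For the two larger degrees, \<open>?s\<close> is bounded by the total degree less the degree of
    \<open>u\<close>.\<close>
  consider "card (nbrs G u) \<le> n - 3" | "card (nbrs G u) = n - 2" | "card (nbrs G u) = n - 1"
    using du n by linarith
  then have "?d u * ?d u + ?s \<le> ?d u * (2 * real n - 4)"
  proof cases
    case 1
    then have "?d u * ?d u \<le> ?d u * (real n - 3)" using n by (intro mult_left_mono) auto
    then show ?thesis using s1 by (simp add: algebra_simps)
  next
    case 2
    then have "card (insert u (nbrs G u)) < card ?V"
      using not_in_nbrs_self[OF G] finite_nbrs[OF G] n by simp
    then obtain w where w: "w \<in> ?V" "w \<notin> insert u (nbrs G u)"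
      using fin by (metis card_mono finite_insert finite_nbrs[OF G] not_le subsetI)
    have "?s + ?d u + ?d w \<le> (\<Sum>v\<in>?V. ?d v)"
    proof -
      have "(\<Sum>v\<in>insert w (insert u (nbrs G u)). ?d v) \<le> (\<Sum>v\<in>?V. ?d v)"
        using fin sub uV w by (intro sum_mono2) auto
      then show ?thesis using w not_in_nbrs_self[OF G] finite_nbrs[OF G] by simp
    qed
    moreover have "?d u = real n - 2" using 2 n by simp
    moreover have "?d w \<ge> 0" by simp
    ultimately have "?s \<le> (real n - 1) * (real n - 2) - (real n - 2)" using total by linarith
    also have "\<dots> = ?d u * (real n - 2)" unfolding \<open>?d u = real n - 2\<close> by (simp add: algebra_simps)
    finally show ?thesis unfolding \<open>?d u = real n - 2\<close> by (simp add: algebra_simps)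
  next
    case 3
    have "?s + ?d u \<le> (\<Sum>v\<in>?V. ?d v)"
    proof -
      have "(\<Sum>v\<in>insert u (nbrs G u). ?d v) \<le> (\<Sum>v\<in>?V. ?d v)"
        using fin sub uV by (intro sum_mono2) auto
      then show ?thesis using not_in_nbrs_self[OF G] finite_nbrs[OF G] by simp
    qed
    moreover have "?d u = real n - 1" using 3 n by simp
    ultimately have "?d u * ?d u + ?s \<le> ?d u * ?d u + (real n - 1) * (real n - 2) - ?d u" using total by linarith
    also have "\<dots> = ?d u * (2 * real n - 4)" unfolding \<open>?d u = real n - 1\<close> by (simp add: algebra_simps)
    finally show ?thesis .
  qed
  with main have "?d u * k \<le> ?d u * (2 * real n - 4)" by (simp add: mult.commute)
  then show False using dpos[OF u(1)] big by simp
qed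

section \<open>The extremal graph\<close>

text \<open>A copy of \<open>H\<^sub>n\<^sub>,\<^sub>a\<close> on the vertex set \<open>V\<close> when \<open>P\<close> has \<open>a - 1\<close> elements: \<open>w\<close> is the vertex of \<open>K\<^sub>1\<close>
  and \<open>P\<close> the vertex set of \<open>K\<^sub>a\<^sub>-\<^sub>1\<close>.\<close>

definition hub_graph :: "'v \<Rightarrow> 'v set \<Rightarrow> 'v set \<Rightarrow> 'v graph" where
  "hub_graph w P V =
     \<lparr>verts = V, edges = {{x, y} | x y. x \<in> V \<and> y \<in> V \<and> x \<noteq> y \<and> (x = w \<longrightarrow> y \<in> P) \<and> (y = w \<longrightarrow> x \<in> P)}\<rparr>"

lemma verts_hub_graph [simp]: "verts (hub_graph w P V) = V"
  by (simp add: hub_graph_def)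

lemma hub_graph_adj [simp]:
  "{x, y} \<in> edges (hub_graph w P V) \<longleftrightarrow>
     x \<in> V \<and> y \<in> V \<and> x \<noteq> y \<and> (x = w \<longrightarrow> y \<in> P) \<and> (y = w \<longrightarrow> x \<in> P)"
  by (auto simp: hub_graph_def doubleton_eq_iff)

lemma card_hub_graph_rest:
  assumes "finite V" "w \<in> V" "P \<subseteq> V - {w}"
  shows "card (V - P - {w}) = card V - 1 - card P"
proof -
  have "V - P - {w} = V - {w} - P" by auto
  moreover have "finite P" using assms finite_subset by blast
  ultimately show ?thesis using assms by (simp add: card_Diff_subset)
qed

lemma simple_hub_graph: "finite V \<Longrightarrow> simple_graph (hub_graph w P V)"
  by (auto simp: simple_graph_def hub_graph_def)

context
  fixes w :: 'v and P V :: "'v set"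
  assumes wV: "w \<in> V" and PV: "P \<subseteq> V - {w}" and finV: "finite V"
begin

lemma nbrs_hub_graph_apex: "nbrs (hub_graph w P V) w = P"
  using wV PV by (auto simp: nbrs_def)

lemma nbrs_hub_graph_hub: "x \<in> P \<Longrightarrow> nbrs (hub_graph w P V) x = V - {x}"
  using PV by (auto simp: nbrs_def)

lemma nbrs_hub_graph_rest: "x \<in> V - P - {w} \<Longrightarrow> nbrs (hub_graph w P V) x = V - {w, x}"
  by (auto simp: nbrs_def)

text \<open>An eigenfunction taking the values \<open>1\<close> on \<open>P\<close>, \<open>\<beta>\<close> at \<open>w\<close> and \<open>\<gamma>\<close> elsewhere has
  \<open>\<beta> = p / (\<theta> - p)\<close> and \<open>\<gamma> = p / (\<theta> - 2n + p + 4)\<close> by the equations at \<open>w\<close> and at the other vertices;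
  the equation on \<open>P\<close> is then \<open>F \<theta> = 0\<close>.\<close>

lemma hub_graph_eigenfunction:
  assumes n: "card V = n" and p: "card P = p" "p \<ge> 1" "p + 2 \<le> n"
    and \<theta>: "\<theta> > 2 * real n - 4" "\<theta> > real p"
    and root: "\<theta> - (real n + real p - 2) - p / (\<theta> - p) - (real n - p - 1) * p / (\<theta> - 2 * real n + p + 4) = 0"
  shows "\<exists>y. eigenfunction (hub_graph w P V) \<theta> y \<and> (\<forall>v\<in>V. y v > 0)"
proof -
  let ?H = "hub_graph w P V"
  define \<beta> where "\<beta> = p / (\<theta> - p)"
  define \<gamma> where "\<gamma> = p / (\<theta> - 2 * real n + p + 4)"
  define y where "y v = (if v = w then \<beta> else if v \<in> P then 1 else \<gamma>)" for v
  have pos: "\<beta> > 0" "\<gamma> > 0" using \<theta> p by (simp_all add: \<beta>_def \<gamma>_def)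
  have eqs: "(\<theta> - p) * \<beta> = p" "(\<theta> - 2 * real n + p + 4) * \<gamma> = p" using \<theta> p by (simp_all add: \<beta>_def \<gamma>_def)
  have root': "\<theta> - (real n + real p - 2) - \<beta> - (real n - p - 1) * \<gamma> = 0"
    using root by (simp add: \<beta>_def \<gamma>_def)
  have wP: "w \<notin> P" and finP: "finite P" using PV finV finite_subset by auto
  have cR: "real (card (V - P - {w})) = real n - p - 1"
    using card_hub_graph_rest[OF finV wV PV] n p by simp
  have sP: "sum y P = p"
    using wP p by (subst sum.cong[of P P y "\<lambda>_. 1"]) (auto simp: y_def)
  have sR: "sum y (V - P - {w}) = (real n - p - 1) * \<gamma>"
    using cR by (subst sum.cong[of _ "V - P - {w}" y "\<lambda>_. \<gamma>"]) (auto simp: y_def)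
  have sV: "sum y V = \<beta> + p + (real n - p - 1) * \<gamma>"
  proof -
    have "sum y V = y w + sum y (V - {w})" using finV wV by (rule sum.remove)
    also have "sum y (V - {w}) = sum y (V - {w} - P) + sum y P"
      using finV PV by (intro sum.subset_diff) auto
    also have "V - {w} - P = V - P - {w}" by auto
    finally show ?thesis using y_def[of w] by (simp add: sP sR)
  qed
  have "real (card (nbrs ?H v)) * y v + (\<Sum>u\<in>nbrs ?H v. y u) = \<theta> * y v" if v: "v \<in> V" for v
  proof -
    consider "v = w" | "v \<in> P" | "v \<in> V - P - {w}" using v by blast
    then show ?thesis
    proof cases
      case 1
      then show ?thesis using eqs(1) y_def[of w] by (simp add: nbrs_hub_graph_apex sP p algebra_simps)
    next
      case 2
      then have "sum y (V - {v}) = sum y V - 1" "card (V - {v}) = n - 1" "y v = 1"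
        using v finV wP n by (auto simp: sum_diff1 y_def)
      then show ?thesis
        using 2 sV root' p by (simp add: nbrs_hub_graph_hub of_nat_diff algebra_simps)
    next
      case 3
      then have "V - {w, v} = V - {w} - {v}" "v \<in> V - {w}" "y v = \<gamma>" by (auto simp: y_def)
      then have "sum y (V - {w, v}) = sum y V - \<beta> - \<gamma>" "card (V - {w, v}) = n - 2"
        using v finV wV n y_def[of w] by (simp_all add: sum_diff1)
      then show ?thesis
        using 3 sV eqs(2) p \<open>y v = \<gamma>\<close> by (simp add: nbrs_hub_graph_rest of_nat_diff algebra_simps)
    qed
  qed
  moreover have "\<exists>v\<in>V. y v \<noteq> 0" using wV pos by (auto simp: y_def)
  ultimately show ?thesis using pos by (intro exI[of _ y]) (auto simp: eigenfunction_def y_def)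
qed

end

text \<open>The intermediate value theorem on \<open>[2n - 4, 2n]\<close>, where both denominators
  are positive. The strict sign at the left end is what yields \<open>q(H) > 2n - 4\<close>.\<close>

lemma hub_graph_root_exists:
  fixes n p :: nat
  assumes "p \<ge> 1" "2 * p + 6 \<le> n"
  shows "\<exists>\<theta>::real. \<theta> > 2 * real n - 4 \<and> \<theta> > real p \<and>
    \<theta> - (real n + real p - 2) - p / (\<theta> - p) - (real n - p - 1) * p / (\<theta> - 2 * real n + p + 4) = 0"
proof -
  define F where "F \<theta> = \<theta> - (real n + real p - 2) - p / (\<theta> - p) - (real n - p - 1) * p / (\<theta> - 2 * real n + p + 4)" for \<theta> :: real
  have np: "real n \<ge> 2 * real p + 6" "real p \<ge> 1" using assms by linarith+
  have lo: "F (2 * real n - 4) < 0"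
  proof -
    \<comment> \<open>At \<open>2n - 4\<close> this denominator is just \<open>p\<close>, so
      \<open>F\<close> equals \<open>-1\<close> minus a positive quotient.\<close>
    have "(real n - p - 1) * p / (2 * real n - 4 - 2 * real n + p + 4) = real n - p - 1" using np by simp
    moreover have "p / (2 * real n - 4 - p) > 0" using np by simp
    ultimately show ?thesis unfolding F_def using np by linarith
  qed
  have hi: "F (2 * real n) \<ge> 0"
  proof -
    define A where "A = p / (2 * real n - p)"
    define B where "B = (real n - p - 1) * p / (real p + 4)"
    have "A \<le> 1" using np by (simp add: A_def)
    moreover have "B \<le> real n - p - 1"
      using np mult_left_mono[of "real p" "real p + 4" "real n - p - 1"] by (simp add: B_def divide_le_eq)
    moreover have "F (2 * real n) = 2 * real n - (real n + real p - 2) - A - B"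
      by (simp add: F_def A_def B_def)
    ultimately show ?thesis by linarith
  qed
  have "\<exists>\<theta>\<ge>2 * real n - 4. \<theta> \<le> 2 * real n \<and> F \<theta> = 0"
  proof (rule IVT')
    show "continuous_on {2 * real n - 4..2 * real n} F"
      unfolding F_def using np by (intro continuous_intros) auto
  qed (use lo hi in auto)
  then obtain \<theta> where \<theta>: "\<theta> \<ge> 2 * real n - 4" "F \<theta> = 0" by blast
  then have "\<theta> \<noteq> 2 * real n - 4" using lo by auto
  then show ?thesis using \<theta> np unfolding F_def by (intro exI[of _ \<theta>]) auto
qed

section \<open>Identification of \<open>H_graph\<close> with a hub graph, and isomorphism of hub
  graphs\<close>

lemma H_graph_verts: "verts (H_graph n a) = {..<a - 1} <+> ({..<1} <+> {..<n - a})"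
  by (simp add: H_graph_def graph_join_def disjoint_union_def complete_graph_def)

lemma image_doubletons: "(\<lambda>e. f ` e) ` {{u, v} | u v. Q u v} = {{f u, f v} | u v. Q u v}"
  by (auto simp: image_iff) (metis image_empty image_insert)

lemma H_graph_edges:
  "edges (H_graph n a) =
     {{Inl i, Inl j} | i j. i < a - 1 \<and> j < a - 1 \<and> i \<noteq> j} \<union>
     {{Inr (Inr i), Inr (Inr j)} | i j. i < n - a \<and> j < n - a \<and> i \<noteq> j} \<union>
     {{Inl i, Inr t} | i t. i < a - 1 \<and> t \<in> {..<1} <+> {..<n - a}}"
proof -
  have complete: "edges (complete_graph m) = {{u, v} | u v. u < m \<and> v < m \<and> u \<noteq> v}" for m
    by (simp add: complete_graph_def)
  have "edges (disjoint_union (complete_graph 1) (complete_graph (n - a))) =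
      {{Inr i, Inr j} | i j. i < n - a \<and> j < n - a \<and> i \<noteq> j}"
    by (simp only: disjoint_union_def complete image_doubletons graph.simps) auto
  then have "edges (disjoint_union (complete_graph (a - 1)) (disjoint_union (complete_graph 1) (complete_graph (n - a)))) =
      {{Inl i, Inl j} | i j. i < a - 1 \<and> j < a - 1 \<and> i \<noteq> j} \<union>
      (\<lambda>e. Inr ` e) ` {{Inr i, Inr j} | i j. i < n - a \<and> j < n - a \<and> i \<noteq> j}"
    by (simp only: disjoint_union_def[of "complete_graph (a - 1)"] complete image_doubletons graph.simps)
  also have "(\<lambda>e. Inr ` e) ` {{Inr i :: nat + nat, Inr j} | i j. i < n - a \<and> j < n - a \<and> i \<noteq> j} =
      {{Inr (Inr i), Inr (Inr j)} | i j. i < n - a \<and> j < n - a \<and> i \<noteq> j}"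
    by (auto simp: image_iff) (metis image_empty image_insert)
  finally show ?thesis
    by (simp add: H_graph_def graph_join_def del: One_nat_def) (simp add: disjoint_union_def complete_graph_def)
qed

text \<open>The only non-adjacent pairs of distinct vertices join the single vertex of
  \<open>K_1\<close>, which is \<open>Inr (Inl 0)\<close>, to a vertex of \<open>K_{n-a}\<close>;
  this is the adjacency rule of the hub graph.\<close>

lemma H_graph_eq_hub_graph:
  "H_graph n a = hub_graph (Inr (Inl 0)) (Inl ` {..<a - 1}) (verts (H_graph n a))"
proof -
  have "e \<in> edges (H_graph n a) \<longleftrightarrow>
      e \<in> edges (hub_graph (Inr (Inl 0)) (Inl ` {..<a - 1}) (verts (H_graph n a)))" for e
  proof
    assume "e \<in> edges (H_graph n a)"
    then consider i j where "e = {Inl i, Inl j}" "i < a - 1" "j < a - 1" "i \<noteq> j"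
      | i j where "e = {Inr (Inr i), Inr (Inr j)}" "i < n - a" "j < n - a" "i \<noteq> j"
      | i t where "e = {Inl i, Inr t}" "i < a - 1" "t \<in> {..<1} <+> {..<n - a}"
      unfolding H_graph_edges by blast
    then show "e \<in> edges (hub_graph (Inr (Inl 0)) (Inl ` {..<a - 1}) (verts (H_graph n a)))"
      by cases (simp_all add: H_graph_verts Plus_def image_iff)
  next
    assume "e \<in> edges (hub_graph (Inr (Inl 0)) (Inl ` {..<a - 1}) (verts (H_graph n a)))"
    then obtain x y where e: "e = {x, y}" and "x \<noteq> y" "x \<in> verts (H_graph n a)" "y \<in> verts (H_graph n a)"
      "x = Inr (Inl 0) \<longrightarrow> y \<in> Inl ` {..<a - 1}" "y = Inr (Inl 0) \<longrightarrow> x \<in> Inl ` {..<a - 1}"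
      by (auto simp: hub_graph_def)
    then consider i j where "x = Inl i" "y = Inl j" "i \<noteq> j" "i < a - 1" "j < a - 1"
      | i t where "{x, y} = {Inl i, Inr t}" "i < a - 1" "t \<in> {..<1} <+> {..<n - a}"
      | i j where "x = Inr (Inr i)" "y = Inr (Inr j)" "i \<noteq> j" "i < n - a" "j < n - a"
      unfolding H_graph_verts by (elim PlusE) (auto simp: insert_commute)
    then show "e \<in> edges (H_graph n a)"
      unfolding e H_graph_edges by cases blast+
  qed
  then have "edges (H_graph n a) =
      edges (hub_graph (Inr (Inl 0)) (Inl ` {..<a - 1}) (verts (H_graph n a)))" by blast
  then show ?thesis by (simp add: hub_graph_def)
qed

lemma card_verts_H_graph: "1 \<le> a \<Longrightarrow> a \<le> n \<Longrightarrow> card (verts (H_graph n a)) = n"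
  by (simp add: H_graph_verts card_Plus)

text \<open>Adjacency of distinct vertices depends only on the blocks (apex, hub, rest) containing
  them, so bijections between corresponding blocks glue to an isomorphism.\<close>

lemma hub_graph_iso:
  assumes fin: "finite V" "finite V'" and card: "card V = card V'" "card P = card P'"
    and w: "w \<in> V" "w' \<in> V'" and P: "P \<subseteq> V - {w}" "P' \<subseteq> V' - {w'}"
  shows "graph_iso (hub_graph w P V) (hub_graph w' P' V')"
proof -
  let ?R = "V - P - {w}" and ?R' = "V' - P' - {w'}"
  have finP: "finite P" "finite P'" using fin P finite_subset by blast+
  then obtain g where g: "bij_betw g P P'" using card finite_same_card_bij by blast
  have "card ?R = card ?R'" using P w fin card by (simp add: card_hub_graph_rest)
  then obtain h where h: "bij_betw h ?R ?R'" using finite_same_card_bij[of ?R ?R'] fin by auto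
  define f where "f x = (if x = w then w' else if x \<in> P then g x else h x)" for x
  have fP: "bij_betw f P P'" using g P by (subst bij_betw_cong[of P f g]) (auto simp: f_def)
  have fR: "bij_betw f ?R ?R'" using h P by (subst bij_betw_cong[of ?R f h]) (auto simp: f_def)
  have fw: "bij_betw f {w} {w'}" by (simp add: f_def bij_betw_def)
  have "bij_betw f ({w} \<union> P \<union> ?R) ({w'} \<union> P' \<union> ?R')"
    by (intro bij_betw_combine fw fP fR) (use P in auto)
  moreover have "{w} \<union> P \<union> ?R = V" "{w'} \<union> P' \<union> ?R' = V'" using w P by auto
  ultimately have f: "bij_betw f V V'" by simp
  have inj: "f x = f y \<longleftrightarrow> x = y" if "x \<in> V" "y \<in> V" for x y
    using f that by (auto simp: bij_betw_def inj_on_def)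
  have fw': "f x = w' \<longleftrightarrow> x = w" if "x \<in> V" for x using inj[OF that w(1)] by (simp add: f_def)
  have fP': "f x \<in> P' \<longleftrightarrow> x \<in> P" if "x \<in> V" for x
  proof -
    have "f ` P = P'" using fP by (simp add: bij_betw_def)
    then have "f x \<in> P' \<longleftrightarrow> (\<exists>u\<in>P. f x = f u)" by auto
    also have "\<dots> \<longleftrightarrow> (\<exists>u\<in>P. x = u)" using inj that P by (intro bex_cong refl) auto
    finally show ?thesis by simp
  qed
  have "f x \<in> V'" if "x \<in> V" for x using f that by (auto simp: bij_betw_def)
  then show ?thesis unfolding graph_iso_def
    using f by (intro exI[of _ f]) (auto simp: inj fw' fP')
qed

section \<open>Dense graphs are covered\<close>

text \<open>Here \<open>s\<close> and \<open>t\<close> are the sizes of \<open>S\<close> and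
  \<open>T\<close>, \<open>\<mu>\<close> counts non-adjacent pairs starting in \<open>T\<close>, and
  \<open>D\<close> is the sum in the cut condition. One \<open>2\<close> allows for the deleted edge
  in \<open>D\<close>, the other for the lowered degrees at its ends.\<close>

lemma deficiency_arith:
  fixes a n s t \<mu> D :: int
  assumes a: "2 \<le> a" and n: "6 * a + 5 \<le> n" and st: "1 \<le> s" "s \<le> t" "2 \<le> t" "s + t \<le> n"
    and mu: "\<mu> \<le> 2 * n - 3" "2 * \<mu> \<le> 2 * n - 3 + t * (t - 1)"
    and D: "t * (n - 1) \<le> D + t * s + \<mu> + 2"
  shows "a * t + 2 \<le> a * s + D"
proof -
  have "\<mu> + 4 \<le> t * (n - 1 - s) - a * (t - s)"
  proof (cases "t = 2")
    case True
    \<comment> \<open>With only two vertices in \<open>T\<close> the bound \<open>2n - 3\<close> on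
      \<open>\<mu>\<close> is too weak; the second bound nearly halves it.\<close>
    then have "2 * \<mu> \<le> 2 * n - 1" using mu(2) by simp
    moreover have "s = 1 \<or> s = 2" using True st by linarith
    ultimately show ?thesis using True a n by auto
  next
    case False
    then have t3: "3 \<le> t" using st by simp
    have "2 * n + 1 \<le> t * (n - 1 - s) - a * (t - s)"
    proof (cases "2 * t \<le> n")
      case small: True
      show ?thesis
      proof (cases "a \<le> t")
        case True
        \<comment> \<open>For \<open>a \<le> t\<close> the worst case is \<open>s = t\<close>; there
          \<open>t * (n - 1 - t)\<close> is concave in \<open>t\<close> and equals
          \<open>3 * (n - 4)\<close> at \<open>t = 3\<close> and \<open>t = n - 4\<close>.\<close>
        have "0 \<le> (t - 3) * (n - 4 - t)" using t3 small a n by (intro mult_nonneg_nonneg) linarith+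
        moreover have "0 \<le> (t - s) * (t - a)" using st True by (intro mult_nonneg_nonneg) linarith+
        ultimately have "3 * (n - 4) \<le> t * (n - 1 - s) - a * (t - s)" by (simp add: algebra_simps)
        moreover have "2 * n + 1 \<le> 3 * (n - 4)" using a n by simp
        ultimately show ?thesis by (rule order_trans[rotated])
      next
        case False
        have "2 * n + 1 \<le> 3 * (n - 1 - 2 * a)" using n by simp
        also have "\<dots> \<le> t * (n - 1 - 2 * a)" using t3 a n by (intro mult_right_mono) linarith+
        also have "\<dots> \<le> t * (n - 1 - s - a)" using st False t3 by (intro mult_left_mono) linarith+
        also have "\<dots> \<le> t * (n - 1 - s) - a * (t - s)"
          using mult_nonneg_nonneg[of a s] a st by (simp add: algebra_simps)
        finally show ?thesis .
      qed
    next
      case False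
      then have "n + 1 \<le> 2 * t" by simp
      \<comment> \<open>At the extreme \<open>2 * t = n + 1\<close> this inequality is exactly
        \<open>n \<ge> 6 * a + 5\<close>.\<close>
      moreover from this have "n + 1 \<le> 3 * (t - 1 - a)" using n by simp
      ultimately have "(n + 1) * (n + 1) \<le> (2 * t) * (3 * (t - 1 - a))"
        using a n t3 by (intro mult_mono) simp_all
      then have "n * n + 2 * n + 1 \<le> 6 * (t * (t - 1 - a))" by (simp add: algebra_simps)
      moreover have "17 * n \<le> n * n" using a n by (intro mult_right_mono) linarith+
      ultimately have "12 * n + 6 \<le> 6 * (t * (t - 1 - a))" using a n by linarith
      then have "2 * n + 1 \<le> t * (t - 1 - a)" by simp
      also have "\<dots> \<le> t * (n - 1 - s - a)" using st by (intro mult_left_mono) linarith+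
      also have "\<dots> \<le> t * (n - 1 - s) - a * (t - s)"
        using mult_nonneg_nonneg[of a s] a st by (simp add: algebra_simps)
      finally show ?thesis .
    qed
    then show ?thesis using mu(1) by linarith
  qed
  then show ?thesis using D by (simp add: algebra_simps)
qed

text \<open>\<open>\<mu>\<close> counts ordered non-adjacent pairs of distinct vertices with first
  entry in \<open>T\<close>. Those leaving \<open>T\<close> recur reversed outside \<open>T\<close>,
  so doubling \<open>\<mu>\<close> exceeds the total only by the pairs inside \<open>T\<close>, at
  most \<open>t (t - 1)\<close> for \<open>t = card T\<close>.\<close>

lemma sum_non_nbrs_bounds:
  assumes G: "simple_graph G" and n: "card (verts G) = n"
    and m: "(\<Sum>x\<in>verts G. card (nbrs G x)) > (n - 1) * (n - 2)" and n2: "n \<ge> 2"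
    and T: "T \<subseteq> verts G"
  defines "\<mu> \<equiv> int (\<Sum>x\<in>T. card (verts G - {x} - nbrs G x))"
  shows "\<mu> \<le> 2 * int n - 3" and "2 * \<mu> \<le> 2 * int n - 3 + int (card T) * (int (card T) - 1)"
proof -
  let ?V = "verts G" and ?N = "\<lambda>x. verts G - {x} - nbrs G x"
  have fin: "finite ?V" using G by (rule simple_graph_finite)
  then have finT: "finite T" using T finite_subset by blast
  have "card (?N x) + card (nbrs G x) = n - 1" if "x \<in> ?V" for x
    using nbrs_subset[OF G, of x] that fin n finite_nbrs[OF G, of x] card_mono[of "?V - {x}" "nbrs G x"]
    by (subst card_Diff_subset) auto
  then have "(\<Sum>x\<in>?V. card (?N x) + card (nbrs G x)) = n * (n - 1)" using n by simp
  then have "(\<Sum>x\<in>?V. card (?N x)) + (\<Sum>x\<in>?V. card (nbrs G x)) = n * (n - 1)" by (simp add: sum.distrib)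
  \<comment> \<open>The strict inequality supplies the \<open>+ 1\<close>; as
    \<open>n (n - 1) - (n - 1) (n - 2) = 2n - 2\<close>, at most \<open>2n - 3\<close> ordered pairs
    are non-adjacent.\<close>
  with m have "(\<Sum>x\<in>?V. card (?N x)) + (n - 1) * (n - 2) + 1 \<le> n * (n - 1)" by linarith
  moreover obtain k where k: "n = 2 + k" using n2 le_Suc_ex by blast
  ultimately have "(\<Sum>x\<in>?V. card (?N x)) + 3 \<le> 2 * n"
    unfolding k by (simp add: algebra_simps)
  then have total: "int (\<Sum>x\<in>?V. card (?N x)) \<le> 2 * int n - 3" by linarith
  have split: "(\<Sum>x\<in>?V. card (?N x)) = (\<Sum>x\<in>?V - T. card (?N x)) + (\<Sum>x\<in>T. card (?N x))"
    using fin T by (rule sum.subset_diff[OF _ _, rotated])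
  then show "\<mu> \<le> 2 * int n - 3" using total unfolding \<mu>_def by linarith
  have "(\<Sum>x\<in>T. card (?N x)) = (\<Sum>x\<in>T. card (?N x \<inter> T)) + (\<Sum>x\<in>T. card (?N x - T))"
    using fin by (subst sum.distrib[symmetric]) (intro sum.cong refl card_Int_Diff finite_Diff)
  moreover have "(\<Sum>x\<in>T. card (?N x \<inter> T)) \<le> card T * (card T - 1)"
  proof -
    have "card (?N x \<inter> T) \<le> card T - 1" if "x \<in> T" for x
      using card_mono[of "T - {x}" "?N x \<inter> T"] finT that by auto
    then have "(\<Sum>x\<in>T. card (?N x \<inter> T)) \<le> (\<Sum>x\<in>T. card T - 1)" by (rule sum_mono)
    then show ?thesis by simp
  qed
  moreover have "(\<Sum>x\<in>T. card (?N x - T)) \<le> (\<Sum>x\<in>?V - T. card (?N x))"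
  proof -
    define M where "M = {(x, y). x \<in> T \<and> y \<in> ?N x - T}"
    have M: "M \<subseteq> T \<times> (?V - T)" by (auto simp: M_def)
    have "(\<Sum>x\<in>T. card (?N x - T)) = (\<Sum>x\<in>T. card {y. (x, y) \<in> M})"
      by (intro sum.cong refl arg_cong[of _ _ card]) (auto simp: M_def)
    also have "\<dots> = (\<Sum>y\<in>?V - T. card {x. (x, y) \<in> M})"
      using sum_card_filter_eq[OF finT _ M] fin by simp
    also have "\<dots> \<le> (\<Sum>y\<in>?V - T. card (?N y))"
      using fin T nbrs_sym[of _ G] by (intro sum_mono card_mono) (auto simp: M_def)
    finally show ?thesis .
  qed
  ultimately have "2 * (\<Sum>x\<in>T. card (?N x)) \<le> (\<Sum>x\<in>?V. card (?N x)) + card T * (card T - 1)"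
    using split by linarith
  then have "2 * \<mu> \<le> int (\<Sum>x\<in>?V. card (?N x)) + int (card T * (card T - 1))"
    unfolding \<mu>_def by linarith
  moreover have "int (card T * (card T - 1)) = int (card T) * (int (card T) - 1)"
    by (cases "card T") (auto simp: algebra_simps)
  ultimately show "2 * \<mu> \<le> 2 * int n - 3 + int (card T) * (int (card T) - 1)" using total by linarith
qed

text \<open>The factor constructed has degree exactly \<open>a\<close> at every vertex, which serves
  every \<open>b \<ge> a\<close>.\<close>

theorem fractional_covered_if_dense:
  assumes G: "simple_graph G" and n: "card (verts G) = n" "n \<ge> 6 * a + 5" and ab: "2 \<le> a" "a \<le> b"
    and deg: "\<And>x. x \<in> verts G \<Longrightarrow> a \<le> card (nbrs G x)"
    and m: "(\<Sum>x\<in>verts G. card (nbrs G x)) > (n - 1) * (n - 2)"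
  shows "fractional_covered a b G"
  unfolding fractional_covered_def
proof
  fix e assume e: "e \<in> edges G"
  let ?V = "verts G"
  have fin: "finite ?V" using G by (rule simple_graph_finite)
  have card_e: "card e = 2" "finite e"
    using G e by (auto simp: simple_graph_def intro: card_ge_0_finite)
  define G' where "G' = \<lparr>verts = ?V, edges = edges G - {e}\<rparr>"
  have G': "simple_graph G'" using G by (auto simp: simple_graph_def G'_def)
  have [simp]: "verts G' = ?V" by (simp add: G'_def)
  define f where "f x = (if x \<in> e then a - 1 else a)" for x
  have f: "f x + of_bool (x \<in> e) = a" for x using ab by (simp add: f_def)
  have f_pos: "1 \<le> f x" for x using f[of x] ab by (auto simp: of_bool_def split: if_splits)
  have nbrs': "nbrs G x \<subseteq> nbrs G' x \<union> (if x \<in> e then e - {x} else {})" for x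
    using not_in_nbrs_self[OF G, of x] by (auto simp: nbrs_def G'_def)
  have e_minus: "card (if x \<in> e then e - {x} else {}) = of_bool (x \<in> e)" for x
    using card_e by simp
  have sum_e: "(\<Sum>x\<in>A. of_bool (x \<in> e)) \<le> (2::nat)" if "finite A" for A
  proof -
    have "(\<Sum>x\<in>A. of_bool (x \<in> e)) = card (A \<inter> e)" using that by (simp add: of_bool_def sum.If_cases Int_def)
    also have "\<dots> \<le> card e" using card_e by (intro card_mono) auto
    finally show ?thesis using card_e by simp
  qed
  have deg': "f x \<le> card (nbrs G' x)" if "x \<in> ?V" for x
  proof -
    have "card (nbrs G x) \<le> card (nbrs G' x \<union> (if x \<in> e then e - {x} else {}))"
      using nbrs'[of x] finite_nbrs[OF G'] card_e by (intro card_mono) auto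
    also have "\<dots> \<le> card (nbrs G' x) + card (if x \<in> e then e - {x} else {})" by (rule card_Un_le)
    finally show ?thesis using deg[OF that] f[of x] e_minus[of x] by linarith
  qed
  have "\<exists>h :: 'a set \<Rightarrow> real. (\<forall>d\<in>edges G'. 0 \<le> h d \<and> h d \<le> 1) \<and>
    (\<forall>x\<in>verts G'. (\<Sum>d\<in>incident_edges G' x. h d) = real (f x))"
  proof (rule fractional_factor_criterion[OF G'])
    fix S T assume "S \<subseteq> verts G'" "T \<subseteq> verts G'" and disj: "S \<inter> T = {}"
    then have S: "S \<subseteq> ?V" "finite S" and T: "T \<subseteq> ?V" "finite T" using fin finite_subset by auto
    let ?D = "\<Sum>x\<in>T. card (nbrs G' x - S)"
    have fS: "sum f S + (\<Sum>x\<in>S. of_bool (x \<in> e)) = a * card S"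
      by (subst sum.distrib[symmetric]) (simp add: f)
    have fT: "sum f T \<le> a * card T" using sum_bounded_above[of T f a] by (simp add: f_def mult.commute)
    \<comment> \<open>An empty \<open>S\<close> and a one-element \<open>T\<close> are settled by
      the minimum degree, a \<open>T\<close> smaller than \<open>S\<close> by the surplus of
      \<open>sum f S\<close>. Only the last case uses that few pairs are non-adjacent.\<close>
    consider "card S = 0" | "card T = 0" | "card T = 1" | "1 \<le> card S" "2 \<le> card T" "card T < card S"
      | "1 \<le> card S" "2 \<le> card T" "card S \<le> card T" by linarith
    then show "sum f T \<le> sum f S + ?D"
    proof cases
      case 1
      then have "S = {}" using S by simp
      then show ?thesis using T deg' by (auto intro!: sum_mono)
    next
      case 2
      then show ?thesis using T by simp
    next
      case 3
      then obtain x where x: "T = {x}" by (meson card_1_singletonE)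
      have "f x \<le> card (nbrs G' x)" using deg' T x by simp
      also have "\<dots> \<le> card (nbrs G' x - S) + card S"
        using finite_nbrs[OF G', of x] S(2) by (meson card_le_sym_Diff diff_card_le_card_Diff le_diff_conv)
      \<comment> \<open>As \<open>a \<ge> 2\<close>, \<open>f\<close> is at least \<open>1\<close>
        even at the ends of \<open>e\<close>, so each vertex of \<open>S\<close> pays for the
        neighbour it may remove.\<close>
      also have "card S \<le> sum f S"
        using sum_mono[of S "\<lambda>_. 1" f] f_pos by simp
      finally show ?thesis using x by simp
    next
      case 4
      \<comment> \<open>One extra vertex in \<open>S\<close> gains \<open>a \<ge> 2\<close>, which
        covers the loss of at most \<open>2\<close> at the ends of \<open>e\<close>.\<close>
      then have "a * (card T + 1) \<le> a * card S" by (intro mult_le_mono) auto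
      then have "a * card T + a \<le> a * card S" by (simp add: algebra_simps)
      with fT fS sum_e[OF S(2)] ab show ?thesis by linarith
    next
      case 5
      let ?N = "\<lambda>x. ?V - {x} - nbrs G x"
      let ?\<mu> = "\<Sum>x\<in>T. card (?N x)"
      have "n - 1 \<le> card (nbrs G' x - S) + card S + card (?N x) + of_bool (x \<in> e)" if "x \<in> T" for x
      proof -
        let ?E = "if x \<in> e then e - {x} else {}"
        \<comment> \<open>A vertex other than \<open>x\<close> is a remaining neighbour outside
          \<open>S\<close>, lies in \<open>S\<close>, is a non-neighbour in \<open>G\<close>, or is
          the other end of \<open>e\<close>.\<close>
        have "?V - {x} \<subseteq> (nbrs G' x - S) \<union> S \<union> ?N x \<union> ?E" using nbrs'[of x] by blast
        then have "card (?V - {x}) \<le> card ((nbrs G' x - S) \<union> S \<union> ?N x \<union> ?E)"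
          using finite_nbrs[OF G', of x] S fin card_e by (intro card_mono) auto
        also have "\<dots> \<le> card (nbrs G' x - S) + card S + card (?N x) + card ?E"
          by (meson add_le_mono card_Un_le order_refl order_trans)
        finally show ?thesis using that T n e_minus[of x] fin by (simp add: subset_iff)
      qed
      then have "(\<Sum>x\<in>T. n - 1) \<le> (\<Sum>x\<in>T. card (nbrs G' x - S) + card S + card (?N x) + of_bool (x \<in> e))"
        by (rule sum_mono)
      then have "card T * (n - 1) \<le> ?D + card T * card S + ?\<mu> + 2"
        using sum_e[OF T(2)] by (simp add: sum.distrib)
      then have "int (card T * (n - 1)) \<le> int (?D + card T * card S + ?\<mu> + 2)" by (rule zle_int[THEN iffD2])
      then have D: "int (card T) * (int n - 1) \<le> int ?D + int (card T) * int (card S) + int ?\<mu> + 2"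
        using n by (simp add: of_nat_diff del: of_nat_sum)
      have "card S + card T \<le> n"
        using card_mono[of ?V "S \<union> T"] card_Un_disjoint[OF S(2) T(2) disj] S T fin n by simp
      then have "int a * int (card T) + 2 \<le> int a * int (card S) + int ?D"
        using 5 ab n
        by (intro deficiency_arith[OF _ _ _ _ _ _ sum_non_nbrs_bounds[OF G n(1) m _ T(1)] D]) auto
      then have "int (a * card T + 2) \<le> int (a * card S + ?D)" by (simp del: of_nat_sum)
      then have "a * card T + 2 \<le> a * card S + ?D" by (rule zle_int[THEN iffD1])
      with fT fS sum_e[OF S(2)] show ?thesis by linarith
    qed
  qed
  then obtain h :: "'a set \<Rightarrow> real" where h: "\<And>d. d \<in> edges G' \<Longrightarrow> 0 \<le> h d \<and> h d \<le> 1"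
    and hf: "\<And>x. x \<in> ?V \<Longrightarrow> (\<Sum>d\<in>incident_edges G' x. h d) = real (f x)" by auto
  define h' where "h' = h(e := 1)"
  have bounds: "0 \<le> h' d \<and> h' d \<le> 1" if "d \<in> edges G" for d
    using h[of d] that by (auto simp: h'_def G'_def)
  have "(\<Sum>d\<in>incident_edges G x. h' d) = real a" if x: "x \<in> ?V" for x
  proof -
    have "finite (incident_edges G' x)"
      using bij_betw_finite[OF bij_betw_nbrs_incident_edges[OF G']] finite_nbrs[OF G'] by blast
    moreover have "e \<notin> incident_edges G' x" by (simp add: incident_edges_def G'_def)
    moreover have "incident_edges G x = (if x \<in> e then insert e (incident_edges G' x) else incident_edges G' x)"
      using e by (auto simp: incident_edges_def G'_def)
    moreover from calculation(2) have "(\<Sum>d\<in>incident_edges G' x. h' d) = (\<Sum>d\<in>incident_edges G' x. h d)"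
      by (intro sum.cong) (auto simp: h'_def)
    ultimately show ?thesis using hf[OF x] ab by (auto simp: h'_def f_def of_nat_diff)
  qed
  then have "fractional_factor a b G h'" using bounds ab by (simp add: fractional_factor_def)
  then show "\<exists>h. fractional_factor a b G h \<and> h e = 1" by (intro exI[of _ h']) (simp add: h'_def)
qed

theorem theorem1p5:
  fixes a b n :: nat and G :: "'v graph"
  assumes "2 \<le> a" and "a \<le> b"
    and "simple_graph G" and "card (verts G) = n" and "n \<ge> 6 * a + 5"
    and "signless_laplacian_radius G \<ge> signless_laplacian_radius (H_graph n a)"
    and "\<not> graph_iso G (H_graph n a)"
  shows "fractional_covered a b G"
proof -
  note G = assms(3) and n = assms(4,5) and a = assms(1)
  let ?V = "verts G" and ?q = "signless_laplacian_radius G"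
  let ?H = "H_graph n a" and ?w = "Inr (Inl 0) :: nat + nat + nat" and ?P = "Inl ` {..<a - 1} :: (nat + nat + nat) set"
  have fin: "finite ?V" using G by (rule simple_graph_finite)
  have H: "finite (verts ?H)" "?w \<in> verts ?H" "?P \<subseteq> verts ?H - {?w}" "card ?P = a - 1"
    "card (verts ?H) = n" "?H = hub_graph ?w ?P (verts ?H)"
    using H_graph_eq_hub_graph[of n a] card_verts_H_graph[of a n] a n
    by (auto simp: H_graph_verts card_image)
  have an: "1 \<le> a - 1" "2 * (a - 1) + 6 \<le> n" "a - 1 + 2 \<le> n" using a n by auto
  from hub_graph_root_exists[OF an(1,2)] obtain \<theta> :: real where
    \<theta>: "\<theta> > 2 * real n - 4" "\<theta> > real (a - 1)" "\<theta> - (real n + real (a - 1) - 2) - real (a - 1) / (\<theta> - real (a - 1)) -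
      (real n - real (a - 1) - 1) * real (a - 1) / (\<theta> - 2 * real n + real (a - 1) + 4) = 0" by auto
  obtain y where "eigenfunction (hub_graph ?w ?P (verts ?H)) \<theta> y"
    using hub_graph_eigenfunction[OF H(2,3,1,5,4) an(1,3) \<theta>] by blast
  \<comment> \<open>\<open>\<theta>\<close> enters as an eigenvalue of \<open>H\<close>, hence as a
    lower bound for \<open>q(H)\<close>, which the hypothesis carries over to
    \<open>G\<close>.\<close>
  then have "\<theta> \<le> signless_laplacian_radius (hub_graph ?w ?P (verts ?H))"
    by (rule eigenfunction_le_signless_laplacian_radius[OF simple_hub_graph[OF H(1)]])
  then have q: "\<theta> \<le> ?q" using assms(6) H(6) by simp
  have "?V \<noteq> {}" using n by auto
  then obtain x where x: "eigenfunction G ?q x" using signless_laplacian_radius_eigenfunction[OF G] by blast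
  have "(\<Sum>v\<in>?V. card (nbrs G v)) > (n - 1) * (n - 2)"
  proof (rule ccontr)
    assume "\<not> ?thesis"
    then have "?q \<le> 2 * real n - 4" using eigenvalue_le_of_few_edges[OF G n(1) _ _ x] n(2) by simp
    then show False using q \<theta>(1) by linarith
  qed
  moreover have "a \<le> card (nbrs G v)" if v: "v \<in> ?V" for v
  proof (rule ccontr)
    assume "\<not> a \<le> card (nbrs G v)"
    then have "card (nbrs G v) \<le> a - 1" "a - 1 \<le> card (?V - {v})" using v n by auto
    \<comment> \<open>Enlarging the neighbourhood of \<open>v\<close> to exactly
      \<open>a - 1\<close> vertices makes \<open>G\<close> a spanning subgraph of a copy of
      \<open>H\<close> with apex \<open>v\<close>.\<close>
    then obtain P where P: "nbrs G v \<subseteq> P" "P \<subseteq> ?V - {v}" "card P = a - 1"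
      using exists_subset_between[OF _ _ nbrs_subset[OF G, of v]] fin by blast
    let ?K = "hub_graph v P ?V"
    have sub: "edges G \<subseteq> edges ?K"
    proof
      fix d assume d: "d \<in> edges G"
      then obtain r s where rs: "d = {r, s}" "r \<noteq> s" "r \<in> ?V" "s \<in> ?V" "s \<in> nbrs G r"
        using edge_cases[OF G] by metis
      then have "r \<in> nbrs G s" using nbrs_sym by metis
      then show "d \<in> edges ?K" using rs P(1) by auto
    qed
    have iso: "graph_iso ?K ?H"
      by (subst H(6), rule hub_graph_iso) (use fin H n v P in auto)
    have "edges G \<noteq> edges ?K"
    proof
      assume "edges G = edges ?K"
      then have "graph_iso G ?H" using iso by (simp add: graph_iso_def)
      then show False using assms(7) by simp
    qed
    with sub have psub: "edges G \<subset> edges ?K" by blast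
    obtain c where c: "c \<in> P" using P(3) an(1) by fastforce
    \<comment> \<open>The root equation involves only \<open>n\<close> and \<open>a - 1\<close>, so
      the same \<open>\<theta>\<close> has a positive eigenfunction on \<open>?K\<close>; no
      equality of radii of isomorphic graphs has to be invoked.\<close>
    obtain z where z: "eigenfunction ?K \<theta> z" "\<And>u. u \<in> ?V \<Longrightarrow> z u > 0"
      using hub_graph_eigenfunction[OF v P(2) fin n(1) P(3) an(1,3) \<theta>] by blast
    have "?q < \<theta>"
    proof (rule eigenvalue_proper_subgraph_less[OF G _ _ psub _ _ z(1) _ x])
      show "verts ?K - {c} \<subseteq> nbrs ?K c" using nbrs_hub_graph_hub[OF v P(2) fin c] by simp
    qed (use z(2) c P fin simple_hub_graph in auto)
    then show False using q by simp
  qed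
  ultimately show ?thesis using fractional_covered_if_dense[OF G n assms(1,2)] by blast
qed

end
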